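(* Let $(\mathbf r(N),\mathbf c(N))_{N\ge2}$ be an input sequence with $r_1(N)\ge c_1(N)\ge2$ for all $N$, and view it as a sequence of tuples $S$. Let $A$ be a property that can be tested for a bipartite graph. Let $p(A)$ be the probability that a graph obtained uniformly at random from $\Omega_{\mathbf r,\mathbf c}$ has property $A$, and let $p'(A)$ be the probability that a graph obtained via the configuration model given $\mathbf r$ and $\mathbf c$ has property $A$. Suppose that, as $N\to\infty$: 1. $\sum_{i=1}^{m}\sum_{j=1}^{n} r_i(r_i-1)c_j(c_j-1)=O(N^2)$; 2. for every subsequence $S'=(\mathbf r'(\ell'),\mathbf c'(\ell'),N'(\ell'))_{\ell'\ge1}$ of $S$, either $\limsup_{\ell'\to\infty}\sum_{i=\kappa(S')}^{\infty}\frac{r'_i(\ell')}{N'(\ell')}>0$ or $\limsup_{\ell'\to\infty}c'_1(\ell')<\kappa(S')$. If $p'(A)=1-o(1)$, then $p(A)=1-o(1)$.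
   Context: Input sequence: for each $N$, $\mathbf r=\mathbf r(N)=(r_1,\dots,r_m)$ and $\mathbf c=\mathbf c(N)=(c_1,\dots,c_n)$ are vectors of non-negative integers (lengths $m=m(N)$, $n=n(N)$ may grow with $N$), in non-increasing order, with $\sum_i r_i=\sum_j c_j=N$. They are extended by $r_i=0$ for $i>m$ and $c_j=0$ for $j>n$. $\Omega_{\mathbf r,\mathbf c}$ is the set of $m\times n$ matrices with entries in $\{0,1\}$ with $i$-th row sum $r_i$ and $j$-th column sum $c_j$ for all $i,j$. An $m\times n$ table with non-negative integer entries is identified with the bipartite (multi)graph on row-vertices $1,\dots,m$ and column-vertices $1,\dots,n$ whose $(i,j)$ entry is the number of edges between row-vertex $i$ and column-vertex $j$; thus elements of $\Omega_{\mathbf r,\mathbf c}$ are simple bipartite graphs with the prescribed degrees. Configuration model: take $r_i$ distinguishable type-1 tokens for each row $i$ and $c_j$ distinguishable type-2 tokens for each column $j$; choose a uniformly random perfect matching (bijection) between the $N$ type-1 tokens and the $N$ type-2 tokens; output the table $T$ where $T_{i,j}$ is the number of type-1 tokens of row $i$ matched to type-2 tokens of column $j$. Viewing the input sequence as a sequence of tuples $(\mathbf r(\ell),\mathbf c(\ell),N(\ell))_\ell$ with $N(\ell)=\ell$, a subsequence is a sequence $(\mathbf r'(\ell'),\mathbf c'(\ell'),N'(\ell'))_{\ell'\ge1}$ such that for some integers $k_1<k_2<\cdots$ one has $\mathbf r'(\ell')=\mathbf r(k_{\ell'})$, $\mathbf c'(\ell')=\mathbf c(k_{\ell'})$, $N'(\ell')=N(k_{\ell'})$.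 For a sequence of tuples $S$, $\kappa(S)=\min\{i\ge1: r_i(\ell)=o(N(\ell))\text{ as }\ell\to\infty\}$, with $\kappa(S)=\infty$ if no such $i$ exists; in that case $\sum_{i=\kappa(S)}^\infty (\cdot)$ is defined to be $0$. $f=O(g)$ means $\limsup f/g<\infty$; $f=o(g)$ means $\lim f/g=0$. *)

theory Defs
  imports "HOL-Probability.Probability" "HOL-Library.Landau_Symbols"
    "Jordan_Normal_Form.Matrix"
begin

text \<open>Degree vectors of varying length are lists. \<open>deg v i\<close> is their i-th entry counted from 1,
  extended by 0 beyond the length. Tables and tokens below use the 0-based indices of lists and
  matrices instead.\<close>

definition deg :: "nat list \<Rightarrow> nat \<Rightarrow> nat" where
  "deg v i = (if 1 \<le> i \<and> i \<le> length v then v ! (i - 1) else 0)"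

definition input_sequence :: "(nat \<Rightarrow> nat list) \<Rightarrow> (nat \<Rightarrow> nat list) \<Rightarrow> bool" where
  "input_sequence r c \<longleftrightarrow>
     (\<forall>N\<ge>2. sorted_wrt (\<ge>) (r N) \<and> sorted_wrt (\<ge>) (c N) \<and>
            sum_list (r N) = N \<and> sum_list (c N) = N)"

text \<open>A bipartite multigraph on m row-vertices and n column-vertices is its m by n table of edge
  multiplicities, a \<open>nat mat\<close>, which carries its dimensions.\<close>

definition Omega :: "nat list \<Rightarrow> nat list \<Rightarrow> nat mat set" where
  "Omega r c =
     {T \<in> carrier_mat (length r) (length c).
        (\<forall>i<length r. \<forall>j<length c. T $$ (i, j) \<in> {0, 1}) \<and>
        (\<forall>i<length r. (\<Sum>j<length c. T $$ (i, j)) = r ! i) \<and>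
        (\<forall>j<length c. (\<Sum>i<length r. T $$ (i, j)) = c ! j)}"

text \<open>For empty \<open>Omega r c\<close> this probability is unspecified (as in the
  informal notion), so it is only meaningful for degree vectors of some simple graph.\<close>

definition prob_uniform :: "nat list \<Rightarrow> nat list \<Rightarrow> (nat mat \<Rightarrow> bool) \<Rightarrow> real" where
  "prob_uniform r c A = measure_pmf.prob (pmf_of_set (Omega r c)) {T. A T}"

text \<open>The token \<open>(i, k)\<close> is the k-th token of row (or column) i.\<close>

definition tokens :: "nat list \<Rightarrow> (nat \<times> nat) set" where
  "tokens v = (SIGMA i:{..<length v}. {..<v ! i})"

text \<open>Restricting to extensional functions makes each matching be counted exactly once.\<close>

definition matchings :: "nat list \<Rightarrow> nat list \<Rightarrow> (nat \<times> nat \<Rightarrow> nat \<times> nat) set" where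
  "matchings r c = {f \<in> extensional (tokens r). bij_betw f (tokens r) (tokens c)}"

definition table :: "nat list \<Rightarrow> nat list \<Rightarrow> (nat \<times> nat \<Rightarrow> nat \<times> nat) \<Rightarrow> nat mat" where
  "table r c f =
     mat (length r) (length c) (\<lambda>(i, j). card {t \<in> tokens r. fst t = i \<and> fst (f t) = j})"

definition configuration_model :: "nat list \<Rightarrow> nat list \<Rightarrow> nat mat pmf" where
  "configuration_model r c = map_pmf (table r c) (pmf_of_set (matchings r c))"

definition prob_configuration :: "nat list \<Rightarrow> nat list \<Rightarrow> (nat mat \<Rightarrow> bool) \<Rightarrow> real" where
  "prob_configuration r c A = measure_pmf.prob (configuration_model r c) {T. A T}"

record degree_tuple =
  row_degs :: "nat list"
  col_degs :: "nat list"
  total :: nat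

definition tuples :: "(nat \<Rightarrow> nat list) \<Rightarrow> (nat \<Rightarrow> nat list) \<Rightarrow> nat \<Rightarrow> degree_tuple" where
  "tuples r c = (\<lambda>l. \<lparr>row_degs = r l, col_degs = c l, total = l\<rparr>)"

text \<open>Input sequences start at index 2, so a subsequence selects indices that are at least 2.
  Subsequences themselves are indexed from 0.\<close>

definition is_subsequence :: "(nat \<Rightarrow> degree_tuple) \<Rightarrow> (nat \<Rightarrow> degree_tuple) \<Rightarrow> bool" where
  "is_subsequence S' S \<longleftrightarrow> (\<exists>k. strict_mono k \<and> (\<forall>l. 2 \<le> k l) \<and> (\<forall>l. S' l = S (k l)))"

definition sublinear_row :: "(nat \<Rightarrow> degree_tuple) \<Rightarrow> nat \<Rightarrow> bool" where
  "sublinear_row S i \<longleftrightarrow> (\<lambda>l. real (deg (row_degs (S l)) i)) \<in> o(\<lambda>l. real (total (S l)))"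

definition kappa :: "(nat \<Rightarrow> degree_tuple) \<Rightarrow> enat" where
  "kappa S = (if \<exists>i\<ge>1. sublinear_row S i
              then enat (LEAST i. 1 \<le> i \<and> sublinear_row S i) else \<infinity>)"

text \<open>The sum over all \<open>i \<ge> kappa S\<close> of the i-th row degree of the l-th tuple divided by its
  total. All but finitely many terms are 0, and the sum is 0 if \<open>kappa S = \<infinity>\<close>.\<close>

definition tail_mass :: "(nat \<Rightarrow> degree_tuple) \<Rightarrow> nat \<Rightarrow> real" where
  "tail_mass S l =
     (\<Sum>i. if kappa S \<le> enat i then real (deg (row_degs (S l)) i) / real (total (S l)) else 0)"

end

theory Submission
  imports Defs
begin

text \<open>Every simple table arises from the same number of token matchings, so the uniform model is
  the configuration model conditioned on simplicity, and it suffices to bound the probability of a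
  simple table away from 0. If the largest row degree is a small fraction of \<open>N\<close>, this follows from
  the lopsided local lemma for random matchings, applied to the events that two given tokens of one
  row are matched to two given tokens of one column. Otherwise the first hypothesis bounds the
  number of tokens in columns of degree at least 2, and the second one provides disjoint groups of
  rows of linear weight, at least as many as the largest column degree: with probability bounded
  below, the k-th token of each such column lands in the k-th group, which excludes multiple
  edges.\<close>

text \<open>The case distinction is forced by rows of linear degree. Such a row has about N^2
  ordered pairs of tokens, so even if all columns have degree 2, a fixed column token takes part in
  a number of events of order N^2, and the related events no longer have small total probability.
  Simplicity may then even be impossible, as with a single row and a column of degree 2; this is
  what the second hypothesis excludes. Large column degrees cause no such trouble, since the first
  hypothesis bounds the product of the two pair counts. The border between the cases is a fixed
  fraction \<epsilon> of N that depends only on the constant in the first hypothesis. Since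
  \<open>kappa\<close> and the limsups see only whole subsequences, the argument goes by
  contradiction: subsequences are refined until the first q rows are linear, and the next one
  sublinear, along the entire sequence.\<close>

lemma card_eq_sum_card_fibres:
  assumes "finite A" "finite B" "g ` A \<subseteq> B"
  shows "card A = (\<Sum>b\<in>B. card {a \<in> A. g a = b})"
  using sum.group[OF assms, of "\<lambda>_. 1::nat"] by simp

section \<open>Bijections between finite sets, as extensional functions\<close>

definition bijs :: "'a set \<Rightarrow> 'b set \<Rightarrow> ('a \<Rightarrow> 'b) set" where
  "bijs X Y = {f \<in> extensional X. bij_betw f X Y}"

lemma finite_bijs:
  assumes "finite X" "finite Y"
  shows "finite (bijs X Y)"
proof (rule finite_subset)
  show "bijs X Y \<subseteq> X \<rightarrow>\<^sub>E Y"
    by (auto simp: bijs_def PiE_def bij_betw_def)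
  show "finite (X \<rightarrow>\<^sub>E Y)"
    using assms by (intro finite_PiE) auto
qed

lemma bijs_memD: "f \<in> bijs X Y \<Longrightarrow> x \<in> X \<Longrightarrow> f x \<in> Y"
  by (auto simp: bijs_def bij_betw_def)

lemma bijs_eq_iff: "f \<in> bijs X Y \<Longrightarrow> x \<in> X \<Longrightarrow> x' \<in> X \<Longrightarrow> f x = f x' \<longleftrightarrow> x = x'"
  by (auto simp: bijs_def bij_betw_def inj_on_def)

lemma bijs_ext:
  "f \<in> bijs X Y \<Longrightarrow> g \<in> bijs X Z \<Longrightarrow> (\<And>x. x \<in> X \<Longrightarrow> f x = g x) \<Longrightarrow> f = g"
  by (auto simp: bijs_def intro: extensionalityI)

lemma restrict_comp_in_bijs:
  assumes "f \<in> bijs X Y" "bij_betw g Y Z"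
  shows "restrict (g \<circ> f) X \<in> bijs X Z"
proof -
  have "bij_betw (g \<circ> f) X Z"
    using assms by (auto simp: bijs_def intro: bij_betw_trans)
  then show ?thesis
    by (simp add: bijs_def cong: bij_betw_cong)
qed

lemma bijs_nonempty:
  assumes "finite X" "finite Y" "card X = card Y"
  shows "bijs X Y \<noteq> {}"
proof -
  obtain h where "bij_betw h X Y"
    using finite_same_card_bij[OF assms] by blast
  then have "restrict h X \<in> bijs X Y"
    by (simp add: bijs_def cong: bij_betw_cong)
  then show ?thesis by blast
qed

section \<open>The lopsided local lemma for random bijections\<close>

text \<open>Two transpositions suffice: the first moves \<open>b1\<close> to \<open>b1'\<close>, the
  second corrects the image of \<open>b2\<close> and leaves \<open>b1'\<close> alone. That only four
  points can move is what keeps unrelated events from being created.\<close>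

lemma ex_permutation_two_points:
  assumes "b1 \<in> Y" "b2 \<in> Y" "b1' \<in> Y" "b2' \<in> Y" "b1 \<noteq> b2" "b1' \<noteq> b2'"
  shows "\<exists>p. bij_betw p Y Y \<and> p b1 = b1' \<and> p b2 = b2' \<and>
           (\<forall>y. y \<notin> {b1, b2, b1', b2'} \<longrightarrow> p y = y)"
proof -
  define q where "q = Transposition.transpose b1 b1'"
  define p where "p = Transposition.transpose (q b2) b2' \<circ> q"
  have q: "q b2 \<in> Y" "bij_betw q Y Y"
    using assms by (auto simp: q_def Transposition.transpose_def bij_betw_transpose_iff)
  have "bij_betw p Y Y"
    unfolding p_def using q assms by (intro bij_betw_trans[OF q(2)]) (auto simp: bij_betw_transpose_iff)
  moreover have "p b1 = b1'" "p b2 = b2'" "\<forall>y. y \<notin> {b1, b2, b1', b2'} \<longrightarrow> p y = y"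
    using assms by (auto simp: p_def q_def Transposition.transpose_def)
  ultimately show ?thesis by blast
qed

fun hits :: "('a \<Rightarrow> 'b) \<Rightarrow> ('a \<times> 'a) \<times> ('b \<times> 'b) \<Rightarrow> bool" where
  "hits f ((a1, a2), (b1, b2)) \<longleftrightarrow> f a1 = b1 \<and> f a2 = b2"

text \<open>Events without a common token are still not independent in a uniform bijection, which is
  why the lopsided form of the local lemma is required.\<close>

fun unrelated :: "('a \<times> 'a) \<times> ('b \<times> 'b) \<Rightarrow> ('a \<times> 'a) \<times> ('b \<times> 'b) \<Rightarrow> bool" where
  "unrelated ((a1, a2), (b1, b2)) ((c1, c2), (d1, d2)) \<longleftrightarrow>
     {a1, a2} \<inter> {c1, c2} = {} \<and> {b1, b2} \<inter> {d1, d2} = {}"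

definition avoiding :: "'a set \<Rightarrow> 'b set \<Rightarrow> (('a \<times> 'a) \<times> ('b \<times> 'b)) set \<Rightarrow> ('a \<Rightarrow> 'b) set" where
  "avoiding X Y S = {f \<in> bijs X Y. \<forall>e\<in>S. \<not> hits f e}"

text \<open>Ordered pairs are used so that counts become the falling factorials n(n-1) of the first
  hypothesis. The price is that each event is listed twice, once for each order of its two token
  pairs.\<close>

definition off_diag :: "'a set \<Rightarrow> ('a \<times> 'a) set" where
  "off_diag X = {(a, b). a \<in> X \<and> b \<in> X \<and> a \<noteq> b}"

lemma finite_off_diag: "finite X \<Longrightarrow> finite (off_diag X)"
  by (rule finite_subset[of _ "X \<times> X"]) (auto simp: off_diag_def)

lemma card_off_diag:
  assumes "finite X"
  shows "card (off_diag X) = card X * (card X - 1)"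
proof -
  have "off_diag X = (SIGMA a:X. X - {a})"
    by (auto simp: off_diag_def)
  then show ?thesis
    using assms by (simp add: card_SigmaI)
qed

lemma finite_avoiding: "finite X \<Longrightarrow> finite Y \<Longrightarrow> finite (avoiding X Y S)"
  unfolding avoiding_def by (rule finite_subset[OF _ finite_bijs]) auto

text \<open>Relabelling column tokens turns a matching that contains an event into one that contains
  any other prescribed pair of images, and it creates no unrelated event. Hence avoiding
  unrelated events can only make an event less likely.\<close>

lemma card_hitting_avoiding_le:
  assumes fin: "finite X" "finite Y"
    and e: "a \<in> off_diag X" "b \<in> off_diag Y"
    and S: "\<And>e'. e' \<in> S \<Longrightarrow> e' \<in> off_diag X \<times> off_diag Y \<and> unrelated (a, b) e'"
  shows "card Y * (card Y - 1) * card {f \<in> avoiding X Y S. hits f (a, b)} \<le> card (avoiding X Y S)"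
proof -
  obtain a1 a2 b1 b2 where ab: "a = (a1, a2)" "b = (b1, b2)" by (cases a, cases b) auto
  have a: "a1 \<in> X" "a2 \<in> X" "a1 \<noteq> a2" and b: "b1 \<in> Y" "b2 \<in> Y" "b1 \<noteq> b2"
    using e by (auto simp: ab off_diag_def)
  let ?A = "avoiding X Y S"
  let ?g = "\<lambda>f. (f a1, f a2)"
  have "card {f \<in> ?A. hits f (a, b)} \<le> card {f \<in> ?A. ?g f = d}" if "d \<in> off_diag Y" for d
  proof -
    obtain d1 d2 where d: "d = (d1, d2)" "d1 \<in> Y" "d2 \<in> Y" "d1 \<noteq> d2"
      using \<open>d \<in> off_diag Y\<close> by (auto simp: off_diag_def)
    obtain p where p: "bij_betw p Y Y" "p b1 = d1" "p b2 = d2"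
      "\<And>y. y \<notin> {b1, b2, d1, d2} \<Longrightarrow> p y = y"
      using ex_permutation_two_points[OF b(1,2) d(2,3) b(3) d(4)] by blast
    let ?F = "\<lambda>f. restrict (p \<circ> f) X"
    show ?thesis
    proof (rule card_inj_on_le)
      show "inj_on ?F {f \<in> ?A. hits f (a, b)}"
      proof (rule inj_onI)
        fix f f' assume f: "f \<in> {f \<in> ?A. hits f (a, b)}" "f' \<in> {f \<in> ?A. hits f (a, b)}"
          and eq: "?F f = ?F f'"
        have ff: "f \<in> bijs X Y" "f' \<in> bijs X Y"
          using f by (auto simp: avoiding_def)
        show "f = f'"
        proof (rule bijs_ext[OF ff])
          fix x assume x: "x \<in> X"
          have "p (f x) = p (f' x)" using fun_cong[OF eq, of x] x by simp
          then show "f x = f' x"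
            using p(1) bijs_memD[OF ff(1) x] bijs_memD[OF ff(2) x]
            by (auto simp: bij_betw_def inj_on_def)
        qed
      qed
      show "finite {f \<in> ?A. ?g f = d}"
        using finite_avoiding[OF fin] by simp
      show "?F ` {f \<in> ?A. hits f (a, b)} \<subseteq> {f \<in> ?A. ?g f = d}"
      proof safe
        fix f assume f: "f \<in> ?A" "hits f (a, b)"
        have fb: "f \<in> bijs X Y" using f by (simp add: avoiding_def)
        have fab: "f a1 = b1" "f a2 = b2" using f by (auto simp: ab)
        have Fb: "?F f \<in> bijs X Y" by (rule restrict_comp_in_bijs[OF fb p(1)])
        have Fa: "?F f a1 = d1" "?F f a2 = d2" using a fab p by auto
        \<comment> \<open>A match outside the event that is present after relabelling was present
          before: \<open>y\<close> is neither \<open>d1\<close> nor \<open>d2\<close>, which are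
          already the images of \<open>a1\<close> and \<open>a2\<close>, so \<open>p\<close> fixes
          it.\<close>
        have key: "f x = y" if "x \<in> X" "x \<noteq> a1" "x \<noteq> a2" "y \<noteq> b1" "y \<noteq> b2" "y \<in> Y" "?F f x = y"
          for x y
        proof -
          have "y \<noteq> d1" "y \<noteq> d2"
            using that Fa bijs_eq_iff[OF Fb that(1) a(1)] bijs_eq_iff[OF Fb that(1) a(2)] by auto
          then have "p y = y" using that p(4) by auto
          moreover have "p (f x) = y" using that by simp
          ultimately show ?thesis
            using p(1) bijs_memD[OF fb that(1)] that by (auto simp: bij_betw_def inj_on_def)
        qed
        have "\<not> hits (?F f) e'" if e': "e' \<in> S" for e'
        proof
          assume h: "hits (?F f) e'"
          obtain x1 x2 y1 y2 where e'_eq: "e' = ((x1, x2), (y1, y2))"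
            by (metis surj_pair)
          have "f x1 = y1 \<and> f x2 = y2"
            using S[OF e'] h unfolding e'_eq ab
            by (intro conjI key) (auto simp: off_diag_def)
          then have "hits f e'" by (simp add: e'_eq)
          then show False using f e' by (auto simp: avoiding_def)
        qed
        then show "?F f \<in> ?A" using Fb by (simp add: avoiding_def)
        show "?g (?F f) = d" using Fa d by auto
      qed
    qed
  qed
  then have "card (off_diag Y) * card {f \<in> ?A. hits f (a, b)} \<le> (\<Sum>d\<in>off_diag Y. card {f \<in> ?A. ?g f = d})"
    by (intro sum_bounded_below[of _ _ "\<lambda>d. card {f \<in> ?A. ?g f = d}", simplified]) auto
  also have "\<dots> = card ?A"
  proof (rule card_eq_sum_card_fibres[symmetric])
    show "?g ` ?A \<subseteq> off_diag Y"
    proof safe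
      fix f assume "f \<in> ?A"
      then have "f \<in> bijs X Y" by (simp add: avoiding_def)
      then show "?g f \<in> off_diag Y"
        using bijs_eq_iff[of f X Y a1 a2] a by (auto simp: off_diag_def bijs_memD)
    qed
  qed (use finite_avoiding[OF fin] finite_off_diag[OF fin(2)] in auto)
  finally show ?thesis by (simp add: card_off_diag[OF fin(2)])
qed

text \<open>The induction step of the symmetric local lemma: by the induction hypothesis, avoiding the at
  most \<open>D\<close> related events loses at most half of the matchings.\<close>

lemma card_hitting_avoiding_le_double:
  assumes fin: "finite X" "finite Y" and n: "card Y \<ge> 2"
    and E: "E \<subseteq> off_diag X \<times> off_diag Y"
    and D: "\<And>e. e \<in> E \<Longrightarrow> card {e' \<in> E. \<not> unrelated e e'} \<le> D"
    and small: "4 * D \<le> card Y * (card Y - 1)"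
    and S: "S \<subseteq> E" and e: "e \<in> E"
  shows "card Y * (card Y - 1) * card {f \<in> avoiding X Y S. hits f e} \<le> 2 * card (avoiding X Y S)"
proof -
  have "finite E"
    using finite_subset[OF E] fin by (simp add: finite_off_diag)
  define P where "P = card Y * (card Y - 1)"
  have "P * card {f \<in> avoiding X Y S. hits f e} \<le> 2 * card (avoiding X Y S)"
    using S e
  proof (induction "card S" arbitrary: S e rule: less_induct)
    case less
    have "finite S" using less.prems \<open>finite E\<close> finite_subset by blast
    define S1 where "S1 = {e' \<in> S. \<not> unrelated e e'}"
    define S2 where "S2 = {e' \<in> S. unrelated e e'}"
    have S12: "S = S1 \<union> S2" "S1 \<inter> S2 = {}" "finite S1" "finite S2"
      using \<open>finite S\<close> by (auto simp: S1_def S2_def)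
    obtain a b where ab: "e = (a, b)" by (metis surj_pair)
    have first: "P * card {f \<in> avoiding X Y S2. hits f e} \<le> card (avoiding X Y S2)"
      unfolding ab P_def using less.prems E
      by (intro card_hitting_avoiding_le[OF fin]) (auto simp: S2_def ab)
    have mono: "card {f \<in> avoiding X Y S. hits f e} \<le> card {f \<in> avoiding X Y S2. hits f e}"
      by (intro card_mono finite_subset[OF _ finite_avoiding[OF fin, of S2]]) (auto simp: avoiding_def S12)
    have half: "card (avoiding X Y S2) \<le> 2 * card (avoiding X Y S)"
    proof (cases "S1 = {}")
      case True
      then show ?thesis using S12 by simp
    next
      case False
      have "card S2 < card S"
        using False S12 by (simp add: card_Un_disjoint card_gt_0_iff)
      then have IH: "P * card {f \<in> avoiding X Y S2. hits f e'} \<le> 2 * card (avoiding X Y S2)"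
        if "e' \<in> S1" for e'
        using less.hyps[of S2 e'] that less.prems S12 by blast
      have "card S1 \<le> D"
        using D[OF less.prems(2)] card_mono[of "{e' \<in> E. \<not> unrelated e e'}" S1] \<open>finite E\<close> less.prems
        by (force simp: S1_def)
      have "avoiding X Y S2 \<subseteq> avoiding X Y S \<union> (\<Union>e'\<in>S1. {f \<in> avoiding X Y S2. hits f e'})"
        by (auto simp: avoiding_def S12)
      then have "card (avoiding X Y S2) \<le> card (avoiding X Y S \<union> (\<Union>e'\<in>S1. {f \<in> avoiding X Y S2. hits f e'}))"
        using finite_avoiding[OF fin] S12 by (intro card_mono) auto
      also have "\<dots> \<le> card (avoiding X Y S) + (\<Sum>e'\<in>S1. card {f \<in> avoiding X Y S2. hits f e'})"
        by (rule order_trans[OF card_Un_le add_left_mono[OF card_UN_le[OF S12(3)]]])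
      finally have "P * card (avoiding X Y S2) \<le>
          P * card (avoiding X Y S) + (\<Sum>e'\<in>S1. P * card {f \<in> avoiding X Y S2. hits f e'})"
        by (simp flip: sum_distrib_left add_mult_distrib2)
      \<comment> \<open>By induction each related event holds for at most a fraction 2/P of
        \<open>avoiding X Y S2\<close>. All of them together cover at most 2D/P <= 1/2; this is the
        origin of the 4 in \<open>small\<close>.\<close>
      also have "(\<Sum>e'\<in>S1. P * card {f \<in> avoiding X Y S2. hits f e'}) \<le> card S1 * (2 * card (avoiding X Y S2))"
        using sum_bounded_above[of S1 "\<lambda>e'. P * card {f \<in> avoiding X Y S2. hits f e'}"] IH by simp
      also have "\<dots> \<le> D * (2 * card (avoiding X Y S2))"
        using \<open>card S1 \<le> D\<close> by (rule mult_le_mono1)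
      finally have "2 * (P * card (avoiding X Y S2)) \<le>
          2 * (P * card (avoiding X Y S)) + (4 * D) * card (avoiding X Y S2)" by simp
      also have "(4 * D) * card (avoiding X Y S2) \<le> P * card (avoiding X Y S2)"
        by (rule mult_le_mono1) (use small in \<open>simp add: P_def\<close>)
      finally have "P * card (avoiding X Y S2) \<le> P * (2 * card (avoiding X Y S))" by simp
      then show ?thesis using n by (simp add: P_def)
    qed
    show ?case
      by (rule order_trans[OF mult_le_mono2[OF mono] order_trans[OF first half]])
  qed
  then show ?thesis by (simp add: P_def)
qed

text \<open>Chain rule: the events are added one at a time, and each removes at most a fraction 2/P
  of the matchings that avoid the earlier ones, where P is the number of ordered pairs of column
  tokens.\<close>

lemma card_avoiding_ge:
  assumes fin: "finite X" "finite Y" and n: "card Y \<ge> 2"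
    and E: "E \<subseteq> off_diag X \<times> off_diag Y"
    and D: "\<And>e. e \<in> E \<Longrightarrow> card {e' \<in> E. \<not> unrelated e e'} \<le> D"
    and small: "4 * D \<le> card Y * (card Y - 1)"
  shows "real (card (avoiding X Y E)) \<ge>
    (1 - 2 / real (card Y * (card Y - 1))) ^ card E * real (card (bijs X Y))"
proof -
  have "finite E"
    using finite_subset[OF E] fin by (simp add: finite_off_diag)
  define P where "P = card Y * (card Y - 1)"
  \<comment> \<open>\<open>P \<ge> 2\<close> keeps the factor \<open>1 - 2 / P\<close> nonnegative,
    so that the induction hypothesis can be multiplied by it.\<close>
  have "2 * 1 \<le> card Y * (card Y - 1)"
    using n by (intro mult_le_mono) auto
  then have P: "P \<ge> 2" by (simp add: P_def)
  have "real (card (avoiding X Y S)) \<ge> (1 - 2 / real P) ^ card S * real (card (bijs X Y))" if "S \<subseteq> E" for S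
    using finite_subset[OF that \<open>finite E\<close>] that
  proof (induction S rule: finite_induct)
    case empty
    then show ?case by (simp add: avoiding_def)
  next
    case (insert e S)
    have "avoiding X Y S = avoiding X Y (insert e S) \<union> {f \<in> avoiding X Y S. hits f e}"
      by (auto simp: avoiding_def)
    then have "card (avoiding X Y S) \<le> card (avoiding X Y (insert e S)) + card {f \<in> avoiding X Y S. hits f e}"
      using card_Un_le[of "avoiding X Y (insert e S)" "{f \<in> avoiding X Y S. hits f e}"] by simp
    moreover have "P * card {f \<in> avoiding X Y S. hits f e} \<le> 2 * card (avoiding X Y S)"
      unfolding P_def using insert.prems by (intro card_hitting_avoiding_le_double[OF fin n E D small]) auto
    then have "real (P * card {f \<in> avoiding X Y S. hits f e}) \<le> real (2 * card (avoiding X Y S))"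
      by (rule of_nat_mono)
    then have "card {f \<in> avoiding X Y S. hits f e} \<le> 2 / real P * card (avoiding X Y S)"
      using P by (simp add: field_simps)
    ultimately have "(1 - 2 / real P) * card (avoiding X Y S) \<le> card (avoiding X Y (insert e S))"
      by (simp add: algebra_simps)
    moreover have "(1 - 2 / real P) * ((1 - 2 / real P) ^ card S * real (card (bijs X Y)))
        \<le> (1 - 2 / real P) * card (avoiding X Y S)"
      using insert P by (intro mult_left_mono) auto
    ultimately show ?case
      using insert by (simp add: mult.assoc)
  qed
  then show ?thesis by (simp add: P_def)
qed

section \<open>Bijections with prescribed ranges of preimages\<close>

text \<open>Swapping the images of two tokens turns a matching satisfying the constraints on \<open>L\<close> into
  one that also satisfies the constraint on \<open>t\<close>; the pair of swapped tokens is determined by the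
  result and one further token.\<close>

lemma card_bijs_constrained_insert:
  assumes fin: "finite X" "finite Y" and L: "finite L" "L \<subseteq> Y"
    and t: "t \<in> Y" "t \<notin> L" and G: "G t \<subseteq> X"
  shows "(card (G t) - card L) * card {f \<in> bijs X Y. \<forall>x\<in>X. f x \<in> L \<longrightarrow> x \<in> G (f x)}
    \<le> card X * card {f \<in> bijs X Y. \<forall>x\<in>X. f x \<in> insert t L \<longrightarrow> x \<in> G (f x)}"
proof -
  let ?B = "{f \<in> bijs X Y. \<forall>x\<in>X. f x \<in> L \<longrightarrow> x \<in> G (f x)}"
  let ?C = "{f \<in> bijs X Y. \<forall>x\<in>X. f x \<in> insert t L \<longrightarrow> x \<in> G (f x)}"
  have finB: "finite ?B" "finite ?C" using finite_bijs[OF fin] by auto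
  define D where "D = (SIGMA f:?B. {x \<in> G t. f x \<notin> L})"
  define y where "y f = inv_into X f t" for f :: "'a \<Rightarrow> 'b"
  have y: "y f \<in> X" "f (y f) = t" if "f \<in> bijs X Y" for f
    using that t(1) by (auto simp: y_def bijs_def bij_betw_def inv_into_into f_inv_into_f)
  have "finite (G t)" using G fin(1) by (rule finite_subset)
  have large: "card (G t) - card L \<le> card {x \<in> G t. f x \<notin> L}" if "f \<in> ?B" for f
  proof -
    \<comment> \<open>Since \<open>f\<close> is injective, at most \<open>card L\<close> members of
      \<open>G t\<close> are already mapped into \<open>L\<close>; the others are free to take over
      \<open>t\<close>.\<close>
    have "card (f -` L \<inter> G t) \<le> card L"
      using that G L(1) by (intro card_inj_on_le[where f = f]) (auto simp: bijs_def bij_betw_def inj_on_def)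
    moreover have "{x \<in> G t. f x \<notin> L} = G t - (f -` L \<inter> G t)" by auto
    ultimately show ?thesis
      using \<open>finite (G t)\<close> by (simp add: card_Diff_subset)
  qed
  have "(card (G t) - card L) * card ?B \<le> (\<Sum>f\<in>?B. card {x \<in> G t. f x \<notin> L})"
    using sum_bounded_below[of ?B "card (G t) - card L" "\<lambda>f. card {x \<in> G t. f x \<notin> L}"] large
    by (simp add: mult.commute)
  also have "\<dots> = card D"
    unfolding D_def using finB \<open>finite (G t)\<close> by (subst card_SigmaI) auto
  also have "\<dots> \<le> card (?C \<times> X)"
  proof (rule card_inj_on_le)
    let ?s = "\<lambda>f x. restrict (f \<circ> Transposition.transpose x (y f)) X"
    let ?F = "\<lambda>(f, x). (?s f x, y f)"
    have s: "?s f x \<in> ?C" "?s f x x = t" if "(f, x) \<in> D" for f x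
    proof -
      have f: "f \<in> bijs X Y" "\<And>x. x \<in> X \<Longrightarrow> f x \<in> L \<Longrightarrow> x \<in> G (f x)"
        and x: "x \<in> X" "x \<in> G t" "f x \<notin> L"
        using that G by (auto simp: D_def)
      have "bij_betw (Transposition.transpose x (y f)) X X"
        using x y[OF f(1)] by (simp add: bij_betw_transpose_iff)
      then have "bij_betw (f \<circ> Transposition.transpose x (y f)) X Y"
        using f(1) by (auto simp: bijs_def intro: bij_betw_trans)
      then have sb: "?s f x \<in> bijs X Y"
        by (simp add: bijs_def cong: bij_betw_cong)
      show st: "?s f x x = t" using x y[OF f(1)] by simp
      have "z \<in> G (?s f x z)" if z: "z \<in> X" "?s f x z \<in> insert t L" for z
      proof (cases "z = x")
        case True
        then show ?thesis using st x by simp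
      next
        case False
        then have "?s f x z \<noteq> t" using bijs_eq_iff[OF sb z(1) x(1)] st by simp
        \<comment> \<open>Besides \<open>x\<close>, only \<open>y f\<close> gets a new image, namely
          \<open>f x\<close>, and this lies outside \<open>L\<close>; so the old constraints
          survive.\<close>
        then have "z \<noteq> y f" "?s f x z = f z" "f z \<in> L"
          using False z x t(2) by (auto simp: Transposition.transpose_def split: if_splits)
        then show ?thesis using f(2)[OF z(1)] by simp
      qed
      then show "?s f x \<in> ?C" using sb by auto
    qed
    show "?F ` D \<subseteq> ?C \<times> X"
      using s(1) y(1) by (auto simp: D_def)
    show "finite (?C \<times> X)" using finB fin by simp
    show "inj_on ?F D"
    proof (rule inj_onI)
      fix d d' assume dd: "d \<in> D" "d' \<in> D" "?F d = ?F d'"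
      obtain f x f' x' where d: "d = (f, x)" "d' = (f', x')" by (metis surj_pair)
      have fx: "(f, x) \<in> D" "(f', x') \<in> D" and eq': "?s f x = ?s f' x'" and yy: "y f = y f'"
        using dd d by auto
      have ff: "f \<in> bijs X Y" "f' \<in> bijs X Y" and xx: "x \<in> X" "x' \<in> X"
        using fx G by (auto simp: D_def)

      have "?s f x x = ?s f x x'" using s(2)[OF fx(1)] s(2)[OF fx(2)] eq' by simp
      moreover have "?s f x \<in> bijs X Y" using s(1)[OF fx(1)] unfolding mem_Collect_eq by (rule conjunct1)
      ultimately have "x = x'"
        using bijs_eq_iff[OF _ xx] by (metis (no_types))
      moreover have "f = f'"
      proof (rule bijs_ext[OF ff])
        fix z assume z: "z \<in> X"
        let ?z = "Transposition.transpose x (y f) z"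
        have "?z \<in> X" using z xx y[OF ff(1)] by (auto simp: Transposition.transpose_def)
        then show "f z = f' z"
          using fun_cong[OF eq', of ?z] \<open>x = x'\<close> yy by simp
      qed
      ultimately show "d = d'" by (simp add: d)
    qed
  qed
  also have "\<dots> = card X * card ?C"
    by (simp add: card_cartesian_product)
  finally show ?thesis .
qed

text \<open>Chain rule over \<open>L\<close>: at each step at most \<open>card L\<close> members of
  \<open>G t\<close> are occupied, so adding the constraint on \<open>t\<close> keeps at least a
  fraction \<open>(s - card L) / card X\<close> of the bijections.\<close>

lemma card_bijs_constrained_ge:
  assumes fin: "finite X" "finite Y" and X: "X \<noteq> {}" and L: "finite L" "L \<subseteq> Y"
    and G: "\<And>t. t \<in> L \<Longrightarrow> G t \<subseteq> X \<and> card (G t) \<ge> s" and s: "card L \<le> s"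
  shows "((real s - real (card L)) / real (card X)) ^ card L * real (card (bijs X Y)) \<le>
    real (card {f \<in> bijs X Y. \<forall>x\<in>X. f x \<in> L \<longrightarrow> x \<in> G (f x)})"
proof -
  define d where "d = (real s - real (card L)) / real (card X)"
  have X0: "card X > 0" using fin X by (simp add: card_gt_0_iff)
  have d: "d \<ge> 0" using s by (simp add: d_def)
  have "d ^ card M * real (card (bijs X Y)) \<le>
    real (card {f \<in> bijs X Y. \<forall>x\<in>X. f x \<in> M \<longrightarrow> x \<in> G (f x)})" if "M \<subseteq> L" for M
    using finite_subset[OF that L(1)] that
  proof (induction M rule: finite_induct)
    case empty
    then show ?case by simp
  next
    case (insert t M)
    let ?B = "{f \<in> bijs X Y. \<forall>x\<in>X. f x \<in> M \<longrightarrow> x \<in> G (f x)}"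
    let ?C = "{f \<in> bijs X Y. \<forall>x\<in>X. f x \<in> insert t M \<longrightarrow> x \<in> G (f x)}"
    have "card M \<le> card L" using insert.prems L(1) by (intro card_mono) auto
    have "(card (G t) - card M) * card ?B \<le> card X * card ?C"
      using insert L G by (intro card_bijs_constrained_insert fin) auto
    moreover have "s - card L \<le> card (G t) - card M"
    proof -
      have "s \<le> card (G t)" using G[of t] insert.prems by auto
      with \<open>card M \<le> card L\<close> show ?thesis by linarith
    qed
    ultimately have "(s - card L) * card ?B \<le> card X * card ?C"
      by (meson le_trans mult_le_mono1)
    then have "real ((s - card L) * card ?B) \<le> real (card X * card ?C)"
      by (rule of_nat_mono)
    then have "d * card ?B \<le> card ?C"
      using s X0 by (simp add: d_def field_simps of_nat_diff)
    moreover have "d * (d ^ card M * real (card (bijs X Y))) \<le> d * card ?B"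
      using insert d by (intro mult_left_mono) auto
    ultimately show ?case
      using insert by (simp add: mult.assoc)
  qed
  then show ?thesis by (simp add: d_def)
qed

section \<open>Simple tables in the configuration model\<close>

lemma matchings_eq_bijs: "matchings r c = bijs (tokens r) (tokens c)"
  by (simp add: matchings_def bijs_def)

lemma finite_tokens: "finite (tokens v)"
  by (simp add: tokens_def)

lemma card_tokens: "card (tokens v) = sum_list v"
  by (simp add: tokens_def card_SigmaI sum_list_sum_nth atLeast0LessThan)

lemma card_tokens_fibre: "card {t \<in> tokens v. fst t = i} = (if i < length v then v ! i else 0)"
proof -
  have "{t \<in> tokens v. fst t = i} = (if i < length v then Pair i ` {..<v ! i} else {})"
    by (auto simp: tokens_def)
  then show ?thesis by (simp add: card_image inj_on_def)
qed

lemma bij_betw_preimage: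
  assumes "bij_betw f X Y" "y \<in> Y"
  obtains x where "x \<in> X" "f x = y"
  using assms unfolding bij_betw_def by blast

lemma finite_matchings: "finite (matchings r c)"
  by (simp add: matchings_eq_bijs finite_bijs finite_tokens)

lemma matchings_nonempty: "sum_list r = sum_list c \<Longrightarrow> matchings r c \<noteq> {}"
  unfolding matchings_eq_bijs by (rule bijs_nonempty) (simp_all add: finite_tokens card_tokens)

text \<open>For the tokens \<open>X\<close> and the edges \<open>E\<close> of a simple graph, such a
  bijection hands to every token one edge at its own vertex. The general form serves both sides,
  with \<open>h = fst\<close> for rows and \<open>h = snd\<close> for columns.\<close>

definition lifts :: "'a set \<Rightarrow> ('a \<Rightarrow> 'i) \<Rightarrow> 'b set \<Rightarrow> ('b \<Rightarrow> 'i) \<Rightarrow> ('a \<Rightarrow> 'b) set" where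
  "lifts X g E h = {f \<in> bijs X E. \<forall>x\<in>X. h (f x) = g x}"

text \<open>A bijection is chosen for each label, and the choices are glued. Injectivity holds
  because the image of a point reveals its label.\<close>

lemma lifts_nonempty:
  assumes fin: "finite X" "finite E"
    and eq: "\<And>i. card {x \<in> X. g x = i} = card {e \<in> E. h e = i}"
  shows "lifts X g E h \<noteq> {}"
proof -
  have "\<forall>i. \<exists>b. bij_betw b {x \<in> X. g x = i} {e \<in> E. h e = i}"
    using fin eq by (intro allI finite_same_card_bij) auto
  then obtain b where b: "\<And>i. bij_betw (b i) {x \<in> X. g x = i} {e \<in> E. h e = i}"
    by metis
  define f where "f = restrict (\<lambda>x. b (g x) x) X"
  have fE: "f x \<in> E" "h (f x) = g x" if "x \<in> X" for x
    using bij_betwE[OF b[of "g x"]] that by (auto simp: f_def)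
  have "inj_on f X"
  proof (rule inj_onI)
    fix x y assume xy: "x \<in> X" "y \<in> X" "f x = f y"
    then have "g x = g y" using fE by metis
    then show "x = y"
      using xy bij_betw_imp_inj_on[OF b[of "g x"]] by (auto simp: f_def inj_on_def)
  qed
  moreover have "E \<subseteq> f ` X"
  proof
    fix e assume e: "e \<in> E"
    then have "e \<in> b (h e) ` {x \<in> X. g x = h e}"
      using bij_betw_imp_surj_on[OF b[of "h e"]] by simp
    then obtain x where "x \<in> X" "g x = h e" "e = b (h e) x" by auto
    then show "e \<in> f ` X" by (intro image_eqI[of _ _ x]) (auto simp: f_def)
  qed
  ultimately have "f \<in> lifts X g E h"
    using fE by (auto simp: lifts_def bijs_def bij_betw_def f_def)
  then show ?thesis by blast
qed

lemma finite_lifts: "finite X \<Longrightarrow> finite E \<Longrightarrow> finite (lifts X g E h)"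
  unfolding lifts_def by (rule finite_subset[OF _ finite_bijs]) auto

lemma card_lifts_le:
  assumes fin: "finite X" "finite E'"
    and q: "bij_betw q E E'" "\<And>e. e \<in> E \<Longrightarrow> h' (q e) = h e"
  shows "card (lifts X g E h) \<le> card (lifts X g E' h')"
proof (rule card_inj_on_le)
  show "inj_on (\<lambda>f. restrict (q \<circ> f) X) (lifts X g E h)"
  proof (rule inj_onI)
    fix f f' assume f: "f \<in> lifts X g E h" "f' \<in> lifts X g E h"
      and eq: "restrict (q \<circ> f) X = restrict (q \<circ> f') X"
    have ff: "f \<in> bijs X E" "f' \<in> bijs X E" using f by (auto simp: lifts_def)
    show "f = f'"
    proof (rule bijs_ext[OF ff])
      fix x assume x: "x \<in> X"
      then show "f x = f' x"
        using fun_cong[OF eq, of x] bij_betw_imp_inj_on[OF q(1)] bijs_memD[OF ff(1) x] bijs_memD[OF ff(2) x]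
        by (auto simp: inj_on_def)
    qed
  qed
  show "(\<lambda>f. restrict (q \<circ> f) X) ` lifts X g E h \<subseteq> lifts X g E' h'"
    using q by (auto simp: lifts_def bijs_memD simp del: restrict_apply intro: restrict_comp_in_bijs)
      (auto simp: lifts_def bijs_memD)
qed (rule finite_lifts[OF fin])

text \<open>Composition with one fixed lift, and with its inverse, exchanges the lifts to
  \<open>E\<close> with the label-preserving permutations of \<open>X\<close>. Thus the number does
  not depend on which graph provided \<open>E\<close>.\<close>

lemma card_lifts_eq:
  assumes fin: "finite X" "finite E"
    and eq: "\<And>i. card {x \<in> X. g x = i} = card {e \<in> E. h e = i}"
  shows "card (lifts X g E h) = card (lifts X g X g)"
proof -
  obtain a where a: "a \<in> lifts X g E h"
    using lifts_nonempty[of X E g h, OF fin eq] by blast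
  then have ab: "bij_betw a X E" "\<And>x. x \<in> X \<Longrightarrow> h (a x) = g x"
    by (auto simp: lifts_def bijs_def)
  have "g (inv_into X a e) = h e" if "e \<in> E" for e
    using ab(2)[of "inv_into X a e"] bij_betw_inv_into_right[OF ab(1) that]
      bij_betwE[OF bij_betw_inv_into[OF ab(1)]] that by simp
  then have "card (lifts X g E h) \<le> card (lifts X g X g)"
    using ab by (intro card_lifts_le[where q = "inv_into X a"] fin) (auto intro: bij_betw_inv_into)
  moreover have "card (lifts X g X g) \<le> card (lifts X g E h)"
    using ab by (intro card_lifts_le[where q = a] fin) auto
  ultimately show ?thesis by simp
qed

section \<open>Edges of a simple table, and the number of matchings producing it\<close>

definition edges :: "nat list \<Rightarrow> nat list \<Rightarrow> nat mat \<Rightarrow> (nat \<times> nat) set" where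
  "edges r c T = {(i, j). i < length r \<and> j < length c \<and> T $$ (i, j) = 1}"

lemma finite_edges: "finite (edges r c T)"
  by (rule finite_subset[of _ "{..<length r} \<times> {..<length c}"]) (auto simp: edges_def)

lemma sum_zero_one_eq_card:
  assumes "finite A" "\<And>x. x \<in> A \<Longrightarrow> f x \<in> {0, 1::nat}"
  shows "(\<Sum>x\<in>A. f x) = card {x \<in> A. f x = 1}"
proof -
  have "(\<Sum>x\<in>A. f x) = (\<Sum>x\<in>A. if f x = 1 then 1 else 0)"
    using assms(2) by (intro sum.cong) auto
  then show ?thesis
    using assms(1) by (simp add: sum.If_cases Int_def)
qed

lemma card_edges_row:
  assumes "T \<in> Omega r c"
  shows "card {e \<in> edges r c T. fst e = i} = (if i < length r then r ! i else 0)"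
proof (cases "i < length r")
  case True
  have "{e \<in> edges r c T. fst e = i} = Pair i ` {j \<in> {..<length c}. T $$ (i, j) = 1}"
    using True by (auto simp: edges_def)
  then have "card {e \<in> edges r c T. fst e = i} = card {j \<in> {..<length c}. T $$ (i, j) = 1}"
    by (simp add: card_image inj_on_def)
  also have "\<dots> = (\<Sum>j<length c. T $$ (i, j))"
    using assms True by (intro sum_zero_one_eq_card[symmetric]) (auto simp: Omega_def)
  finally show ?thesis using assms True by (simp add: Omega_def)
next
  case False
  then have empty: "{e \<in> edges r c T. fst e = i} = {}"
    by (auto simp: edges_def)
  show ?thesis using False by (simp only: empty if_False card.empty)
qed

lemma card_edges_col:
  assumes "T \<in> Omega r c"
  shows "card {e \<in> edges r c T. snd e = j} = (if j < length c then c ! j else 0)"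
proof (cases "j < length c")
  case True
  have "{e \<in> edges r c T. snd e = j} = (\<lambda>i. (i, j)) ` {i \<in> {..<length r}. T $$ (i, j) = 1}"
    using True by (auto simp: edges_def)
  then have "card {e \<in> edges r c T. snd e = j} = card {i \<in> {..<length r}. T $$ (i, j) = 1}"
    by (simp add: card_image inj_on_def)
  also have "\<dots> = (\<Sum>i<length r. T $$ (i, j))"
    using assms True by (intro sum_zero_one_eq_card[symmetric]) (auto simp: Omega_def)
  finally show ?thesis using assms True by (simp add: Omega_def)
next
  case False
  then have empty: "{e \<in> edges r c T. snd e = j} = {}"
    by (auto simp: edges_def)
  show ?thesis using False by (simp only: empty if_False card.empty)
qed

lemma card_table_entry:
  assumes "i < length r" "j < length c"
  shows "table r c f $$ (i, j) = card {t \<in> tokens r. fst t = i \<and> fst (f t) = j}"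
  using assms by (simp add: table_def)

text \<open>A matching of a simple table \<open>T\<close> amounts to a bijective labelling of the edges of \<open>T\<close> by
  the row tokens together with one by the column tokens; the number of such labellings depends
  only on the degrees.\<close>

lemma card_table_fibre:
  assumes T: "T \<in> Omega r c"
  shows "card {f \<in> matchings r c. table r c f = T} =
    card (lifts (tokens r) fst (tokens r) fst) * card (lifts (tokens c) fst (tokens c) fst)"
proof -
  let ?X = "tokens r" and ?Y = "tokens c" and ?E = "edges r c T"
  let ?A = "lifts ?X fst ?E fst" and ?B = "lifts ?Y fst ?E snd"
  let ?F = "{f \<in> matchings r c. table r c f = T}"
  \<comment> \<open>A row token is matched to the column token that labels the same edge.\<close>
  define P where "P = (\<lambda>(a :: nat \<times> nat \<Rightarrow> nat \<times> nat, b). restrict (\<lambda>t. inv_into ?Y b (a t)) ?X)"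
  have T01: "T $$ (i, j) \<in> {0, 1}" if "i < length r" "j < length c" for i j
    using T that by (auto simp: Omega_def)
  have Pb: "b (P (a, b) t) = a t" "P (a, b) t \<in> ?Y" and Pbij: "P (a, b) \<in> bijs ?X ?Y"
    if "a \<in> ?A" "b \<in> ?B" "t \<in> ?X" for a b t
  proof -
    have ab: "bij_betw a ?X ?E" "bij_betw b ?Y ?E"
      using that by (auto simp: lifts_def bijs_def)
    have at: "a t \<in> ?E" using ab(1) that by (auto simp: bij_betw_def)
    show "b (P (a, b) t) = a t"
      using bij_betw_inv_into_right[OF ab(2) at] that by (simp add: P_def)
    have "bij_betw (inv_into ?Y b \<circ> a) ?X ?Y"
      using ab(1) bij_betw_inv_into[OF ab(2)] by (rule bij_betw_trans)
    then show "P (a, b) \<in> bijs ?X ?Y"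
      by (simp add: P_def bijs_def comp_def cong: bij_betw_cong)
    then show "P (a, b) t \<in> ?Y" using that by (auto intro: bijs_memD)
  qed
  \<comment> \<open>The edge of a row token can be read off the matching: its row is that of the
    token, its column that of the partner. So the matching determines \<open>a\<close>, and through
    \<open>a\<close> also \<open>b\<close>.\<close>
  have aP: "a t = (fst t, fst (P (a, b) t))" if ab: "a \<in> ?A" "b \<in> ?B" and t: "t \<in> ?X" for a b t
  proof -
    have "fst (a t) = fst t" using ab t by (auto simp: lifts_def)
    moreover have "snd (a t) = fst (P (a, b) t)"
      using ab Pb[OF ab t] by (auto simp: lifts_def)
    ultimately show ?thesis by (simp add: prod_eq_iff)
  qed
  have "bij_betw P (?A \<times> ?B) ?F"
  proof (rule bij_betw_imageI)
    show "inj_on P (?A \<times> ?B)"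
    proof (rule inj_onI)
      fix d d' assume dd: "d \<in> ?A \<times> ?B" "d' \<in> ?A \<times> ?B" "P d = P d'"
      obtain a b a' b' where d: "d = (a, b)" "d' = (a', b')" by (metis surj_pair)
      have ab: "a \<in> ?A" "b \<in> ?B" "a' \<in> ?A" "b' \<in> ?B" and eq: "P (a, b) = P (a', b')"
        using dd d by auto
      have bs: "a \<in> bijs ?X ?E" "a' \<in> bijs ?X ?E" "b \<in> bijs ?Y ?E" "b' \<in> bijs ?Y ?E"
        using ab by (auto simp: lifts_def)
      have "a = a'"
      proof (rule bijs_ext[OF bs(1,2)])
        fix x assume x: "x \<in> ?X"
        show "a x = a' x"
          unfolding aP[OF ab(1,2) x] aP[OF ab(3,4) x] eq ..
      qed
      have "b = b'"
      proof (rule bijs_ext[OF bs(3,4)])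
        fix u assume u: "u \<in> ?Y"
        have "bij_betw a ?X ?E" using bs(1) by (simp add: bijs_def)
        then obtain t where t: "t \<in> ?X" "a t = b u"
          using bijs_memD[OF bs(3) u] by (rule bij_betw_preimage)
        have "b (P (a, b) t) = b u" using Pb(1)[OF ab(1,2) t(1)] t by simp
        then have "P (a, b) t = u"
          using bijs_eq_iff[OF bs(3) Pb(2)[OF ab(1,2) t(1)] u] by simp
        then show "b u = b' u"
          using Pb(1)[OF ab(3,4) t(1)] eq t \<open>a = a'\<close> by simp
      qed
      then show "d = d'" using d \<open>a = a'\<close> by simp
    qed
    show "P ` (?A \<times> ?B) = ?F"
    proof (intro equalityI subsetI)
      fix f assume "f \<in> P ` (?A \<times> ?B)"
      then obtain a b where ab: "a \<in> ?A" "b \<in> ?B" and f: "f = P (a, b)" by auto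
      have "bij_betw (\<lambda>t. inv_into ?Y b (a t)) ?X ?Y"
        using bij_betw_trans[of a ?X ?E "inv_into ?Y b" ?Y] ab bij_betw_inv_into[of b ?Y ?E]
        by (auto simp: lifts_def bijs_def comp_def)
      then have fM: "f \<in> matchings r c"
        by (simp add: matchings_eq_bijs f P_def bijs_def cong: bij_betw_cong)
      have "table r c f = T"
      proof (rule eq_matI)
        fix i j assume "i < dim_row T" "j < dim_col T"
        then have ij: "i < length r" "j < length c" using T by (auto simp: Omega_def)
        have set_eq: "{t \<in> ?X. fst t = i \<and> fst (f t) = j} = {t \<in> ?X. a t = (i, j)}"
        proof -
          have "a t = (i, j) \<longleftrightarrow> fst t = i \<and> fst (f t) = j" if "t \<in> ?X" for t
            unfolding aP[OF ab that] f by (rule prod.inject)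
          then show ?thesis by blast
        qed
        have a: "bij_betw a ?X ?E" using ab by (auto simp: lifts_def bijs_def)
        show "table r c f $$ (i, j) = T $$ (i, j)"
        proof (cases "(i, j) \<in> ?E")
          case True
          obtain t where t: "t \<in> ?X" "a t = (i, j)"
            using a True by (rule bij_betw_preimage)
          then have "{t \<in> ?X. a t = (i, j)} = {t}"
            using a by (auto simp: bij_betw_def inj_on_def)
          then show ?thesis
            using True by (simp add: card_table_entry[OF ij] set_eq edges_def)
        next
          case False
          have none: "{t \<in> ?X. a t = (i, j)} = {}"
          proof (rule equals0I)
            fix t assume "t \<in> {t \<in> ?X. a t = (i, j)}"
            then have "t \<in> ?X" "a t = (i, j)" by simp_all
            then show False using bij_betwE[OF a] False by metis
          qed
          have "T $$ (i, j) = 0" using False T01[OF ij] ij by (auto simp: edges_def)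
          then show ?thesis
            unfolding card_table_entry[OF ij] set_eq none by simp
        qed
      qed (use T in \<open>auto simp: table_def Omega_def\<close>)
      then show "f \<in> ?F" using fM by simp
    next
      fix f assume "f \<in> ?F"
      then have f: "f \<in> bijs ?X ?Y" "table r c f = T" by (auto simp: matchings_eq_bijs)
      then have fb: "bij_betw f ?X ?Y" by (simp add: bijs_def)
      \<comment> \<open>The inverse of \<open>P\<close>: a row token gets the edge between its row
        and the column of its partner, and a column token gets the edge of the row token matched to
        it.\<close>
      define a where "a = restrict (\<lambda>t. (fst t, fst (f t))) ?X"
      define b where "b = restrict (\<lambda>u. a (inv_into ?X f u)) ?Y"
      have entry: "card {t \<in> ?X. a t = (i, j)} = T $$ (i, j)" if "i < length r" "j < length c" for i j
      proof -
        have "{t \<in> ?X. a t = (i, j)} = {t \<in> ?X. fst t = i \<and> fst (f t) = j}"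
          by (auto simp: a_def)
        then show ?thesis using card_table_entry[OF that, of f] f(2) by simp
      qed
      have range: "fst t < length r" "fst (f t) < length c" if "t \<in> ?X" for t
        using that bijs_memD[OF f(1) that] by (auto simp: tokens_def)
      have "bij_betw a ?X ?E"
      proof (rule bij_betw_imageI)
        show "inj_on a ?X"
        proof (rule inj_onI)
          fix s t assume st: "s \<in> ?X" "t \<in> ?X" "a s = a t"
          \<comment> \<open>Both tokens belong to a set whose size is an entry of \<open>T\<close>,
            hence at most 1.\<close>
          have "card {u \<in> ?X. a u = (fst t, fst (f t))} \<le> 1"
            unfolding entry[OF range[OF st(2)]] using T01[OF range[OF st(2)]] by auto
          moreover have "{s, t} \<subseteq> {u \<in> ?X. a u = (fst t, fst (f t))}"
            using st by (auto simp: a_def)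
          ultimately show "s = t"
            using card_mono[of "{u \<in> ?X. a u = (fst t, fst (f t))}" "{s, t}"] finite_tokens
            by (cases "s = t") auto
        qed
        show "a ` ?X = ?E"
        proof (intro equalityI subsetI)
          fix e assume "e \<in> a ` ?X"
          then obtain t where t: "t \<in> ?X" "e = (fst t, fst (f t))" by (auto simp: a_def)
          then have "t \<in> {u \<in> ?X. a u = e}" by (simp add: a_def)
          moreover have "finite {u \<in> ?X. a u = e}" using finite_tokens by simp
          ultimately have "card {u \<in> ?X. a u = e} \<noteq> 0" by (metis card_0_eq empty_iff)
          then have "T $$ e \<noteq> 0"
            using entry[OF range[OF t(1)]] t by simp
          then show "e \<in> ?E" using T01[OF range[OF t(1)]] range[OF t(1)] t by (auto simp: edges_def)
        next
          fix e assume "e \<in> ?E"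
          then obtain i j where e: "e = (i, j)" "i < length r" "j < length c" "T $$ (i, j) = 1"
            by (auto simp: edges_def)
          then have "card {u \<in> ?X. a u = e} \<noteq> 0" using entry[OF e(2,3)] by simp
          then have "{u \<in> ?X. a u = e} \<noteq> {}" by (metis card.empty)
          then show "e \<in> a ` ?X" by auto
        qed
      qed
      then have a: "a \<in> ?A" "bij_betw a ?X ?E" by (auto simp: lifts_def bijs_def a_def)
      have "bij_betw (a \<circ> inv_into ?X f) ?Y ?E"
        using bij_betw_inv_into[OF fb] a(2) by (rule bij_betw_trans)
      then have bb: "bij_betw b ?Y ?E"
        by (simp add: b_def comp_def cong: bij_betw_cong)
      moreover have "snd (b u) = fst u" if "u \<in> ?Y" for u
        using bij_betw_inv_into_right[OF fb that] bij_betwE[OF bij_betw_inv_into[OF fb]] that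
        by (simp add: b_def a_def)
      ultimately have b: "b \<in> ?B" by (auto simp: lifts_def bijs_def b_def)
      have "f = P (a, b)"
      proof (rule bijs_ext[OF f(1)])
        show "P (a, b) \<in> bijs ?X ?Y"
        proof -
          have "bij_betw (inv_into ?Y b \<circ> a) ?X ?Y"
            using a(2) bij_betw_inv_into[OF bb] by (rule bij_betw_trans)
          then show ?thesis by (simp add: P_def bijs_def comp_def cong: bij_betw_cong)
        qed
        fix t assume t: "t \<in> ?X"
        have "b (f t) = a t"
          using bij_betw_inv_into_left[OF fb t] bijs_memD[OF f(1) t] by (simp add: b_def)
        then show "f t = P (a, b) t"
          using bij_betw_inv_into_left[OF bb bijs_memD[OF f(1) t]] t by (simp add: P_def)
      qed
      then show "f \<in> P ` (?A \<times> ?B)" using a(1) b by blast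
    qed
  qed
  then have "card ?F = card ?A * card ?B"
    by (simp add: bij_betw_same_card[symmetric] card_cartesian_product)
  moreover have "card ?A = card (lifts ?X fst ?X fst)"
    by (intro card_lifts_eq finite_tokens finite_edges)
      (simp only: card_tokens_fibre card_edges_row[OF T])
  moreover have "card ?B = card (lifts ?Y fst ?Y fst)"
    by (intro card_lifts_eq finite_tokens finite_edges)
      (simp only: card_tokens_fibre card_edges_col[OF T])
  ultimately show ?thesis by simp
qed

lemma finite_Omega: "finite (Omega r c)"
proof -
  let ?I = "{..<length r} \<times> {..<length c}"
  have "Omega r c \<subseteq> mat (length r) (length c) ` (?I \<rightarrow>\<^sub>E {0, 1})"
  proof
    fix T assume T: "T \<in> Omega r c"
    have "T = mat (length r) (length c) (restrict (\<lambda>p. T $$ p) ?I)"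
      by (rule eq_matI) (use T in \<open>auto simp: Omega_def\<close>)
    moreover have "restrict (\<lambda>p. T $$ p) ?I \<in> ?I \<rightarrow>\<^sub>E {0, 1}"
      by (rule restrict_PiE_iff[THEN iffD2]) (use T in \<open>simp add: Omega_def\<close>)
    ultimately show "T \<in> mat (length r) (length c) ` (?I \<rightarrow>\<^sub>E {0, 1})" by blast
  qed
  then show ?thesis
    by (rule finite_subset) (intro finite_imageI finite_PiE; simp)
qed

lemma card_matchings_table_in:
  assumes "S \<subseteq> Omega r c"
  shows "card {f \<in> matchings r c. table r c f \<in> S} =
    card S * (card (lifts (tokens r) fst (tokens r) fst) * card (lifts (tokens c) fst (tokens c) fst))"
proof -
  let ?A = "{f \<in> matchings r c. table r c f \<in> S}"
  have "finite S" using finite_Omega assms by (rule finite_subset[rotated])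
  then have "card ?A = (\<Sum>T\<in>S. card {f \<in> ?A. table r c f = T})"
    using finite_matchings by (intro card_eq_sum_card_fibres) auto
  also have "\<dots> = (\<Sum>T\<in>S. card {f \<in> matchings r c. table r c f = T})"
  proof (rule sum.cong)
    fix T assume "T \<in> S"
    then have "{f \<in> ?A. table r c f = T} = {f \<in> matchings r c. table r c f = T}" by auto
    then show "card {f \<in> ?A. table r c f = T} = card {f \<in> matchings r c. table r c f = T}" by simp
  qed simp
  also have "\<dots> = (\<Sum>T\<in>S. card (lifts (tokens r) fst (tokens r) fst) * card (lifts (tokens c) fst (tokens c) fst))"
    using assms by (intro sum.cong card_table_fibre) auto
  finally show ?thesis by simp
qed

text \<open>A collision of this map is a double edge: two tokens of one row matched into one
  column.\<close>

definition simple_matching :: "nat list \<Rightarrow> (nat \<times> nat \<Rightarrow> nat \<times> nat) \<Rightarrow> bool" where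
  "simple_matching r f \<longleftrightarrow> inj_on (\<lambda>t. (fst t, fst (f t))) (tokens r)"

lemma table_in_Omega:
  assumes f: "f \<in> matchings r c" and simple: "simple_matching r f"
  shows "table r c f \<in> Omega r c"
proof -
  have fb: "bij_betw f (tokens r) (tokens c)" using f by (simp add: matchings_def)
  have row: "(\<Sum>j<length c. table r c f $$ (i, j)) = r ! i" if i: "i < length r" for i
  proof -
    have "(\<Sum>j<length c. table r c f $$ (i, j)) =
        (\<Sum>j<length c. card {t \<in> {t \<in> tokens r. fst t = i}. fst (f t) = j})"
      using i by (intro sum.cong) (simp_all add: card_table_entry)
    also have "\<dots> = card {t \<in> tokens r. fst t = i}"
    proof (rule card_eq_sum_card_fibres[symmetric])
      show "(\<lambda>t. fst (f t)) ` {t \<in> tokens r. fst t = i} \<subseteq> {..<length c}"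
      proof (rule image_subsetI)
        fix t assume "t \<in> {t \<in> tokens r. fst t = i}"
        then have "f t \<in> tokens c" using bij_betwE[OF fb] by blast
        then show "fst (f t) \<in> {..<length c}" by (auto simp: tokens_def)
      qed
    qed (simp_all add: finite_tokens)
    finally show ?thesis using i by (simp only: card_tokens_fibre if_True)
  qed
  have col: "(\<Sum>i<length r. table r c f $$ (i, j)) = c ! j" if j: "j < length c" for j
  proof -
    have "(\<Sum>i<length r. table r c f $$ (i, j)) =
        (\<Sum>i<length r. card {t \<in> {t \<in> tokens r. fst (f t) = j}. fst t = i})"
      using j by (intro sum.cong) (simp_all add: card_table_entry conj_ac)
    also have "\<dots> = card {t \<in> tokens r. fst (f t) = j}"
      by (rule card_eq_sum_card_fibres[symmetric]) (auto simp: finite_tokens tokens_def)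
    also have "\<dots> = card (f ` {t \<in> tokens r. fst (f t) = j})"
      using fb by (intro card_image[symmetric]) (auto simp: bij_betw_def inj_on_def)
    also have "f ` {t \<in> tokens r. fst (f t) = j} = {u \<in> tokens c. fst u = j}"
    proof (intro equalityI subsetI)
      fix u assume "u \<in> {u \<in> tokens c. fst u = j}"
      moreover from this have "u \<in> tokens c" by simp
      with fb obtain t where "t \<in> tokens r" "f t = u" by (rule bij_betw_preimage)
      ultimately show "u \<in> f ` {t \<in> tokens r. fst (f t) = j}"
        by (intro image_eqI[of _ _ t]) simp_all
    qed (use fb in \<open>auto simp: bij_betw_def\<close>)
    finally show ?thesis using j by (simp only: card_tokens_fibre if_True)
  qed
  have zo: "table r c f $$ (i, j) \<in> {0, 1}" if "i < length r" "j < length c" for i j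
  proof -
    have "card {t \<in> tokens r. fst t = i \<and> fst (f t) = j} \<le> card {(i, j)}"
      using simple by (intro card_inj_on_le[where f = "\<lambda>t. (fst t, fst (f t))"])
        (auto simp: simple_matching_def inj_on_def)
    then show ?thesis using that by (auto simp: card_table_entry)
  qed
  show ?thesis
    using row col zo by (simp add: Omega_def table_def)
qed

definition simple_prob :: "nat list \<Rightarrow> nat list \<Rightarrow> real" where
  "simple_prob r c = real (card {f \<in> matchings r c. simple_matching r f}) / real (card (matchings r c))"

text \<open>Conditioning on an event of probability at least \<open>d\<close>, here simplicity,
  multiplies the probability of a failure by at most \<open>1 / d\<close>. The common fibre size
  \<open>F\<close> cancels.\<close>

lemma uniform_failure_le:
  assumes eq: "sum_list r = sum_list c" and d: "d > 0" "simple_prob r c \<ge> d"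
  shows "0 \<le> 1 - prob_uniform r c A"
    and "1 - prob_uniform r c A \<le> (1 - prob_configuration r c A) / d"
proof -
  let ?M = "matchings r c"
  define F where "F = card (lifts (tokens r) fst (tokens r) fst) * card (lifts (tokens c) fst (tokens c) fst)"
  have M: "finite ?M" "?M \<noteq> {}" "card ?M > 0"
    using finite_matchings matchings_nonempty[OF eq] by (auto simp: card_gt_0_iff)
  show "0 \<le> 1 - prob_uniform r c A" by (simp add: prob_uniform_def)
  have conf: "1 - prob_configuration r c A = card {f \<in> ?M. \<not> A (table r c f)} / card ?M"
  proof -
    have "prob_configuration r c A = card (?M \<inter> {f. A (table r c f)}) / card ?M"
      using M by (simp add: prob_configuration_def configuration_model_def measure_pmf_of_set vimage_def)
    moreover have "{f \<in> ?M. \<not> A (table r c f)} = ?M - {f. A (table r c f)}" by auto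
    moreover have "real (card ?M) = card (?M \<inter> {f. A (table r c f)}) + card (?M - {f. A (table r c f)})"
      using card_Int_Diff[OF M(1), of "{f. A (table r c f)}"] by (simp only: of_nat_add)
    ultimately show ?thesis using M(3) by (simp only:) (simp add: field_simps)
  qed
  have "d * card ?M \<le> card {f \<in> ?M. simple_matching r f}"
    using d M by (simp add: simple_prob_def field_simps)
  also have "\<dots> \<le> card {f \<in> ?M. table r c f \<in> Omega r c}"
    using M table_in_Omega by (intro of_nat_mono card_mono) auto
  finally have dM: "d * card ?M \<le> card (Omega r c) * F"
    using card_matchings_table_in[of "Omega r c" r c] by (simp add: F_def)
  \<comment> \<open>The bound by \<open>d\<close> also shows that \<open>Omega r c\<close> is
    nonempty, without which \<open>pmf_of_set\<close> would be unspecified.\<close>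
  have "0 < d * card ?M" using d M by simp
  then have "0 < real (card (Omega r c) * F)" using dM by linarith
  then have pos: "card (Omega r c) > 0" "F > 0"
    by (auto simp del: of_nat_mult)
  then have Om: "Omega r c \<noteq> {}" by auto
  have unif: "1 - prob_uniform r c A = card {T \<in> Omega r c. \<not> A T} / card (Omega r c)"
  proof -
    have "prob_uniform r c A = card (Omega r c \<inter> {T. A T}) / card (Omega r c)"
      using Om finite_Omega by (simp add: prob_uniform_def measure_pmf_of_set)
    moreover have "{T \<in> Omega r c. \<not> A T} = Omega r c - {T. A T}" by auto
    moreover have "real (card (Omega r c)) = card (Omega r c \<inter> {T. A T}) + card (Omega r c - {T. A T})"
      using card_Int_Diff[OF finite_Omega, of r c "{T. A T}"] by (simp only: of_nat_add)
    ultimately show ?thesis using pos(1) by (simp only:) (simp add: field_simps)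
  qed
  have "card {T \<in> Omega r c. \<not> A T} * F = card {f \<in> ?M. table r c f \<in> {T \<in> Omega r c. \<not> A T}}"
    by (subst card_matchings_table_in) (auto simp: F_def)
  also have "\<dots> \<le> card {f \<in> ?M. \<not> A (table r c f)}"
    using M by (intro card_mono) auto
  finally have bad: "real (card {T \<in> Omega r c. \<not> A T} * F) \<le> card {f \<in> ?M. \<not> A (table r c f)}"
    by (rule of_nat_mono)
  have "1 - prob_uniform r c A = real (card {T \<in> Omega r c. \<not> A T} * F) / real (card (Omega r c) * F)"
    using pos by (simp add: unif)
  also have "\<dots> \<le> card {f \<in> ?M. \<not> A (table r c f)} / (d * card ?M)"
    using bad dM \<open>0 < d * card ?M\<close> by (intro frac_le) auto
  also have "\<dots> = (1 - prob_configuration r c A) / d"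
    by (simp add: conf)
  finally show "1 - prob_uniform r c A \<le> (1 - prob_configuration r c A) / d" .
qed

section \<open>Lower bounds for the probability of a simple table\<close>

text \<open>This counts ordered pairs of distinct tokens with a common index (see
  \<open>card_twins\<close>). The product of the two counts for rows and columns is the double sum
  of the first hypothesis.\<close>

definition pair_count :: "nat list \<Rightarrow> nat" where
  "pair_count v = (\<Sum>i<length v. v ! i * (v ! i - 1))"

definition twins :: "nat list \<Rightarrow> ((nat \<times> nat) \<times> (nat \<times> nat)) set" where
  "twins v = {(a, b) \<in> off_diag (tokens v). fst a = fst b}"

lemma twins_subset: "twins v \<subseteq> off_diag (tokens v)"
  by (auto simp: twins_def)

lemma finite_twins: "finite (twins v)"
  using twins_subset finite_off_diag[OF finite_tokens] by (rule finite_subset)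

lemma card_siblings:
  assumes "a \<in> tokens v"
  shows "card ({t \<in> tokens v. fst t = fst a} - {a}) = v ! fst a - 1"
proof -
  have "fst a < length v" using assms by (auto simp: tokens_def)
  then show ?thesis
    using assms card_tokens_fibre[of v "fst a"] by (subst card_Diff_singleton) simp_all
qed

lemma card_twins: "card (twins v) = pair_count v"
proof -
  have "twins v = (SIGMA a:tokens v. {t \<in> tokens v. fst t = fst a} - {a})"
    by (auto simp: twins_def off_diag_def)
  then have "card (twins v) = (\<Sum>a\<in>tokens v. card ({t \<in> tokens v. fst t = fst a} - {a}))"
    by (simp only:) (rule card_SigmaI, simp_all add: finite_tokens)
  also have "\<dots> = (\<Sum>a\<in>tokens v. v ! fst a - 1)"
    by (intro sum.cong card_siblings refl)
  also have "\<dots> = (\<Sum>i<length v. \<Sum>k<v ! i. v ! i - 1)"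
    unfolding tokens_def by (subst sum.Sigma) (simp_all add: case_prod_beta)
  finally show ?thesis by (simp add: pair_count_def)
qed

lemma card_twins_fst_le:
  assumes "\<And>i. i < length v \<Longrightarrow> v ! i \<le> m"
  shows "card {p \<in> twins v. fst p = a} \<le> m - 1"
proof (cases "a \<in> tokens v")
  case True
  have "fst a < length v" using True by (auto simp: tokens_def)
  have "card {p \<in> twins v. fst p = a} \<le> card ({t \<in> tokens v. fst t = fst a} - {a})"
    by (rule card_inj_on_le[where f = snd])
      (auto simp: twins_def off_diag_def inj_on_def finite_tokens)
  then show ?thesis
    using assms[OF \<open>fst a < length v\<close>] unfolding card_siblings[OF True] by linarith
next
  case False
  then have "{p \<in> twins v. fst p = a} = {}"
    by (auto simp: twins_def off_diag_def)
  then show ?thesis by (simp only: card.empty)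
qed

text \<open>The factor 4 stands for two given tokens, each in one of two positions of the
  pair.\<close>

lemma card_twins_meeting_le:
  assumes "\<And>i. i < length v \<Longrightarrow> v ! i \<le> m"
  shows "card {p \<in> twins v. {a1, a2} \<inter> {fst p, snd p} \<noteq> {}} \<le> 4 * (m - 1)"
proof -
  have fst_le: "card {p \<in> twins v. fst p = a} \<le> m - 1" for a
    using assms by (rule card_twins_fst_le)
  have snd_le: "card {p \<in> twins v. snd p = a} \<le> m - 1" for a
  proof -
    have "card {p \<in> twins v. snd p = a} \<le> card {p \<in> twins v. fst p = a}"
      using finite_twins by (intro card_inj_on_le[where f = prod.swap])
        (auto simp: twins_def off_diag_def inj_on_def)
    then show ?thesis using fst_le[of a] by simp
  qed
  let ?U = "({p \<in> twins v. fst p = a1} \<union> {p \<in> twins v. snd p = a1}) \<union>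
    ({p \<in> twins v. fst p = a2} \<union> {p \<in> twins v. snd p = a2})"
  have "card {p \<in> twins v. {a1, a2} \<inter> {fst p, snd p} \<noteq> {}} \<le> card ?U"
    using finite_twins by (intro card_mono) auto
  also have "\<dots> \<le> (card {p \<in> twins v. fst p = a1} + card {p \<in> twins v. snd p = a1}) +
    (card {p \<in> twins v. fst p = a2} + card {p \<in> twins v. snd p = a2})"
    by (rule order_trans[OF card_Un_le add_mono[OF card_Un_le card_Un_le]])
  also have "\<dots> \<le> 4 * (m - 1)"
    using fst_le[of a1] fst_le[of a2] snd_le[of a1] snd_le[of a2] by linarith
  finally show ?thesis .
qed

text \<open>This identifies the bad events for the local lemma: the two tokens of a double edge are
  row twins, and by injectivity their images are distinct, hence column twins.\<close>

lemma simple_matchings_eq_avoiding: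
  "{f \<in> matchings r c. simple_matching r f} = avoiding (tokens r) (tokens c) (twins r \<times> twins c)"
proof -
  have "simple_matching r f \<longleftrightarrow> (\<forall>e\<in>twins r \<times> twins c. \<not> hits f e)"
    if f: "f \<in> bijs (tokens r) (tokens c)" for f
  proof
    assume simple: "simple_matching r f"
    show "\<forall>e\<in>twins r \<times> twins c. \<not> hits f e"
    proof (intro ballI notI)
      fix e assume e: "e \<in> twins r \<times> twins c" "hits f e"
      obtain a1 a2 b1 b2 where ab: "e = ((a1, a2), (b1, b2))" by (metis surj_pair)
      have "a1 = a2"
      proof (rule inj_onD[OF simple[unfolded simple_matching_def]])
        show "a1 \<in> tokens r" "a2 \<in> tokens r" "(fst a1, fst (f a1)) = (fst a2, fst (f a2))"
          using e unfolding ab by (auto simp: twins_def off_diag_def)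
      qed
      then show False using e unfolding ab by (simp add: twins_def off_diag_def)
    qed
  next
    assume avoid: "\<forall>e\<in>twins r \<times> twins c. \<not> hits f e"
    show "simple_matching r f"
      unfolding simple_matching_def
    proof (rule inj_onI, rule ccontr)
      fix a1 a2 assume a: "a1 \<in> tokens r" "a2 \<in> tokens r"
        "(fst a1, fst (f a1)) = (fst a2, fst (f a2))" "a1 \<noteq> a2"
      have "f a1 \<noteq> f a2" using bijs_eq_iff[OF f a(1,2)] a(4) by simp
      then have "((a1, a2), (f a1, f a2)) \<in> twins r \<times> twins c"
        using a bijs_memD[OF f a(1)] bijs_memD[OF f a(2)] by (simp add: twins_def off_diag_def)
      then show False using avoid by force
    qed
  qed
  then show ?thesis
    unfolding avoiding_def matchings_eq_bijs by blast
qed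

lemma simple_prob_ge_power:
  assumes N: "sum_list r = N" "sum_list c = N" "N \<ge> 2"
    and mr: "\<And>i. i < length r \<Longrightarrow> r ! i \<le> mr" and mc: "\<And>j. j < length c \<Longrightarrow> c ! j \<le> mc"
    and small: "16 * ((mr - 1) * pair_count c + (mc - 1) * pair_count r) \<le> N * (N - 1)"
  shows "(1 - 2 / real (N * (N - 1))) ^ (pair_count r * pair_count c) \<le> simple_prob r c"
proof -
  let ?E = "twins r \<times> twins c"
  \<comment> \<open>An event related to \<open>e\<close> either shares a row token, leaving at most
    \<open>4 * (mr - 1)\<close> row twins with arbitrary column twins, or symmetrically a column
    token. The 16 in \<open>small\<close> is this 4 times the 4 of the local lemma.\<close>
  define D where "D = 4 * ((mr - 1) * pair_count c + (mc - 1) * pair_count r)"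
  have "card {e' \<in> ?E. \<not> unrelated e e'} \<le> D" if "e \<in> ?E" for e
  proof -
    obtain a1 a2 b1 b2 where e: "e = ((a1, a2), (b1, b2))" by (metis surj_pair)
    let ?R = "{p \<in> twins r. {a1, a2} \<inter> {fst p, snd p} \<noteq> {}}"
    let ?C = "{p \<in> twins c. {b1, b2} \<inter> {fst p, snd p} \<noteq> {}}"
    have "{e' \<in> ?E. \<not> unrelated e e'} \<subseteq> ?R \<times> twins c \<union> twins r \<times> ?C"
    proof
      fix e' assume e': "e' \<in> {e' \<in> ?E. \<not> unrelated e e'}"
      obtain x1 x2 y1 y2 where "e' = ((x1, x2), (y1, y2))" by (metis surj_pair)
      with e' e show "e' \<in> ?R \<times> twins c \<union> twins r \<times> ?C"
        by (simp add: disj_commute)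
    qed
    then have "card {e' \<in> ?E. \<not> unrelated e e'} \<le> card (?R \<times> twins c \<union> twins r \<times> ?C)"
      using finite_twins by (intro card_mono) auto
    also have "\<dots> \<le> card ?R * pair_count c + pair_count r * card ?C"
      by (rule order_trans[OF card_Un_le]) (simp add: card_cartesian_product card_twins)
    also have "\<dots> \<le> 4 * (mr - 1) * pair_count c + pair_count r * (4 * (mc - 1))"
      using card_twins_meeting_le[of r mr a1 a2, OF mr] card_twins_meeting_le[of c mc b1 b2, OF mc]
      by (intro add_mono mult_le_mono) simp_all
    finally show ?thesis by (simp add: D_def algebra_simps)
  qed
  then have "(1 - 2 / real (card (tokens c) * (card (tokens c) - 1))) ^ card ?E *
      real (card (bijs (tokens r) (tokens c))) \<le> real (card (avoiding (tokens r) (tokens c) ?E))"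
    using N small twins_subset
    by (intro card_avoiding_ge[where D = D] finite_tokens Sigma_mono) (simp_all add: card_tokens D_def)
  then have "(1 - 2 / real (N * (N - 1))) ^ (pair_count r * pair_count c) * real (card (matchings r c))
      \<le> real (card {f \<in> matchings r c. simple_matching r f})"
    by (simp only: card_tokens N card_cartesian_product card_twins matchings_eq_bijs[symmetric]
        simple_matchings_eq_avoiding[symmetric])
  moreover have "card (matchings r c) > 0"
    using matchings_nonempty[of r c] finite_matchings N by (simp add: card_gt_0_iff)
  ultimately show ?thesis by (simp only: simple_prob_def pos_le_divide_eq of_nat_0_less_iff)
qed

text \<open>Put x = 2/P with P = N(N-1). Since 1 - x >= exp(-2x) for x <= 1/2 and the exponent is at
  most K P, the bound becomes exp(-4K). The condition \<open>N \<ge> 3\<close> ensures x <=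
  1/2.\<close>

lemma simple_prob_ge_exp:
  assumes N: "sum_list r = N" "sum_list c = N" "N \<ge> 3"
    and mr: "\<And>i. i < length r \<Longrightarrow> r ! i \<le> mr" and mc: "\<And>j. j < length c \<Longrightarrow> c ! j \<le> mc"
    and small: "16 * ((mr - 1) * pair_count c + (mc - 1) * pair_count r) \<le> N * (N - 1)"
    and prod: "real (pair_count r * pair_count c) \<le> K * real (N * (N - 1))"
  shows "exp (- 4 * K) \<le> simple_prob r c"
proof -
  define P where "P = real (N * (N - 1))"
  define x where "x = 2 / P"
  have "3 * 2 \<le> N * (N - 1)" using N(3) by (intro mult_le_mono) auto
  then have P: "P \<ge> 6"
    using of_nat_mono[of "3 * 2" "N * (N - 1)", where 'a = real] unfolding P_def by simp
  then have x: "0 \<le> x" "x \<le> 1/2" by (auto simp: x_def field_simps)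
  have "x * x \<le> 1 / 2 * x" using x by (intro mult_right_mono) auto
  then have "- 2 * x \<le> - x - 2 * x\<^sup>2" by (simp add: power2_eq_square)
  also have "\<dots> \<le> ln (1 - x)" using x by (rule ln_one_minus_pos_lower_bound)
  finally have ln: "- 2 * x \<le> ln (1 - x)" .
  have "real (pair_count r * pair_count c) * x \<le> K * P * x"
    using prod x by (intro mult_right_mono) (auto simp: P_def)
  also have "\<dots> = 2 * K" using P by (simp add: x_def)
  finally have "real (pair_count r * pair_count c) * x \<le> 2 * K" .
  moreover have "real (pair_count r * pair_count c) * (- 2 * x) = - 2 * (real (pair_count r * pair_count c) * x)"
    by (simp only: mult_ac)
  ultimately have "- 4 * K \<le> real (pair_count r * pair_count c) * (- 2 * x)" by linarith
  also have "\<dots> \<le> real (pair_count r * pair_count c) * ln (1 - x)"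
    using ln by (intro mult_left_mono) auto
  finally have "exp (- 4 * K) \<le> exp (real (pair_count r * pair_count c) * ln (1 - x))"
    by simp
  also have "\<dots> = exp (ln (1 - x)) ^ (pair_count r * pair_count c)"
    by (rule exp_of_nat_mult)
  also have "\<dots> = (1 - x) ^ (pair_count r * pair_count c)"
    using x by simp
  also have "\<dots> \<le> simple_prob r c"
    unfolding x_def P_def using N(3) by (intro simple_prob_ge_power[OF N(1,2) _ mr mc small]) auto
  finally show ?thesis .
qed

text \<open>Only columns of degree at least 2 can carry a double edge, so only their tokens are
  constrained. Their number is at most \<open>pair_count c\<close>, because d <= d(d-1) for d >= 2.
  Two tokens of one column have different second components, so they are sent to disjoint groups of
  rows.\<close>

lemma simple_prob_ge_groups:
  assumes N: "sum_list r = N" "sum_list c = N" "N > 0"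
    and G: "\<And>k. k < q \<Longrightarrow> G k \<subseteq> {..<length r} \<and> (\<Sum>i\<in>G k. r ! i) \<ge> s"
    and disj: "disjoint_family_on G {..<q}"
    and q: "\<And>j. j < length c \<Longrightarrow> c ! j \<le> q"
    and s: "pair_count c \<le> s" "s \<le> N"
  shows "((real s - real (pair_count c)) / real N) ^ pair_count c \<le> simple_prob r c"
proof -
  define L where "L = {t \<in> tokens c. c ! fst t \<ge> 2}"
  define H where "H t = {x \<in> tokens r. fst x \<in> G (snd t)}" for t :: "nat \<times> nat"
  let ?X = "tokens r" and ?Y = "tokens c"
  let ?B = "{f \<in> bijs ?X ?Y. \<forall>x\<in>?X. f x \<in> L \<longrightarrow> x \<in> H (f x)}"
  have "L = (SIGMA j:{..<length c}. if c ! j \<ge> 2 then {..<c ! j} else {})"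
    by (auto simp: L_def tokens_def split: if_splits)
  then have "card L = (\<Sum>j<length c. if c ! j \<ge> 2 then c ! j else 0)"
    by (simp add: card_SigmaI if_distrib cong: if_cong)
  also have "\<dots> \<le> pair_count c"
    unfolding pair_count_def by (rule sum_mono) auto
  finally have cL: "card L \<le> pair_count c" .
  have H: "H t \<subseteq> ?X \<and> card (H t) \<ge> s" if "t \<in> L" for t
  proof -
    have t: "fst t < length c" "snd t < c ! fst t"
      using that by (auto simp: L_def tokens_def)
    then have "snd t < q" using q[OF t(1)] by simp
    note Gt = G[OF this]
    have "H t = (SIGMA i:G (snd t). {..<r ! i})"
      using Gt by (auto simp: H_def tokens_def)
    moreover have "finite (G (snd t))" using Gt by (meson finite_lessThan finite_subset)
    ultimately have "card (H t) = (\<Sum>i\<in>G (snd t). r ! i)"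
      by (simp add: card_SigmaI)
    then show ?thesis using Gt by (simp add: H_def)
  qed
  have "?X \<noteq> {}" using N by (metis card.empty card_tokens less_irrefl)
  then have "((real s - real (card L)) / real (card ?X)) ^ card L * real (card (bijs ?X ?Y)) \<le> real (card ?B)"
    using cL s H by (intro card_bijs_constrained_ge finite_tokens) (auto simp: L_def finite_tokens)
  also have "real (card ?B) \<le> real (card {f \<in> matchings r c. simple_matching r f})"
  proof (intro of_nat_mono card_mono subsetI)
    fix f assume fB: "f \<in> ?B"
    then have f: "f \<in> bijs ?X ?Y" and fH: "\<And>x. x \<in> ?X \<Longrightarrow> f x \<in> L \<Longrightarrow> x \<in> H (f x)" by auto
    have "simple_matching r f"
      unfolding simple_matching_def
    proof (rule inj_onI, rule ccontr)
      fix x y assume xy: "x \<in> ?X" "y \<in> ?X" "(fst x, fst (f x)) = (fst y, fst (f y))" "x \<noteq> y"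
      have "f x \<noteq> f y" using bijs_eq_iff[OF f xy(1,2)] xy(4) by simp
      then have snd_ne: "snd (f x) \<noteq> snd (f y)" using xy(3) by (auto simp: prod_eq_iff)
      have fxy: "f x \<in> ?Y" "f y \<in> ?Y" using bijs_memD[OF f] xy by auto
      then have lt: "fst (f x) < length c" "snd (f x) < c ! fst (f x)" "snd (f y) < c ! fst (f x)"
        using xy(3) by (auto simp: tokens_def)
      then have "c ! fst (f x) \<ge> 2" using snd_ne by linarith
      then have "f x \<in> L" "f y \<in> L" using fxy xy(3) by (auto simp: L_def)
      then have "fst x \<in> G (snd (f x))" "fst x \<in> G (snd (f y))"
        using fH[OF xy(1)] fH[OF xy(2)] xy(3) by (auto simp: H_def)
      moreover have "snd (f x) < q" "snd (f y) < q" using lt q[OF lt(1)] by auto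
      ultimately show False using disj snd_ne by (auto simp: disjoint_family_on_def)
    qed
    then show "f \<in> {f \<in> matchings r c. simple_matching r f}"
      using f by (simp add: matchings_eq_bijs)
  qed (simp add: finite_matchings)
  finally have main: "((real s - real (card L)) / real N) ^ card L * real (card (matchings r c)) \<le>
      real (card {f \<in> matchings r c. simple_matching r f})"
    by (simp only: card_tokens N matchings_eq_bijs)
  \<comment> \<open>Replacing \<open>card L\<close> by the larger \<open>pair_count c\<close>
    weakens the bound both in the base and, as the base is at most 1, in the exponent.\<close>
  let ?b = "(real s - real (pair_count c)) / real N"
  have "?b ^ pair_count c \<le> ?b ^ card L"
    using s N cL by (intro power_decreasing) (auto simp: field_simps)
  also have "\<dots> \<le> ((real s - real (card L)) / real N) ^ card L"
    using s N cL by (intro power_mono divide_right_mono) auto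
  also have "\<dots> \<le> simple_prob r c"
  proof -
    have "card (matchings r c) > 0"
      using matchings_nonempty[of r c] finite_matchings N by (simp add: card_gt_0_iff)
    then show ?thesis using main by (simp only: simple_prob_def pos_le_divide_eq of_nat_0_less_iff)
  qed
  finally show ?thesis .
qed

section \<open>Pair counts of sorted degree vectors\<close>

lemma deg_Suc: "i < length v \<Longrightarrow> deg v (Suc i) = v ! i"
  by (simp add: deg_def)

lemma deg_antimono:
  assumes "sorted_wrt (\<ge>) v" "1 \<le> i" "i \<le> j"
  shows "deg v j \<le> deg v i"
proof (cases "i = j \<or> length v < j")
  case True
  then show ?thesis by (auto simp: deg_def)
next
  case False
  then have "i - 1 < j - 1" "j - 1 < length v" using assms by auto
  then show ?thesis
    using assms False sorted_wrt_nth_less[OF assms(1)] by (auto simp: deg_def)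
qed

lemma nth_le_deg_1:
  assumes "sorted_wrt (\<ge>) v" "i < length v"
  shows "v ! i \<le> deg v 1"
  using deg_antimono[OF assms(1), of 1 "Suc i"] deg_Suc[OF assms(2)] by simp

lemma pair_count_ge:
  assumes "i < length v"
  shows "v ! i * (v ! i - 1) \<le> pair_count v"
  unfolding pair_count_def
  by (rule member_le_sum[of i "{..<length v}" "\<lambda>i. v ! i * (v ! i - 1)"]) (use assms in auto)

lemma pair_count_ge_deg: "deg v 1 * (deg v 1 - 1) \<le> pair_count v"
  using pair_count_ge[of 0 v] by (cases "v = []") (auto simp: deg_def Suc_le_eq)

lemma pair_count_le:
  assumes "sorted_wrt (\<ge>) v"
  shows "pair_count v \<le> sum_list v * (deg v 1 - 1)"
proof -
  have "pair_count v \<le> (\<Sum>i<length v. v ! i * (deg v 1 - 1))"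
    unfolding pair_count_def using nth_le_deg_1[OF assms]
    by (intro sum_mono mult_le_mono diff_le_mono) auto
  then show ?thesis
    by (simp add: sum_distrib_right[symmetric] sum_list_sum_nth atLeast0LessThan)
qed

lemma sum_deg_products_eq:
  "(\<Sum>i=1..length v. \<Sum>j=1..length w. real (deg v i) * (real (deg v i) - 1) *
      real (deg w j) * (real (deg w j) - 1)) = real (pair_count v * pair_count w)"
proof -
  have pc: "(\<Sum>i=1..length u. deg u i * (deg u i - 1)) = pair_count u" for u
    unfolding pair_count_def by (simp add: sum.atLeast1_atMost_eq deg_Suc)
  \<comment> \<open>At \<open>n = 0\<close> truncated and real subtraction differ, but the factor
    \<open>n\<close> vanishes.\<close>
  have falling: "real n * (real n - 1) = real (n * (n - 1))" for n
    by (cases n) (simp_all add: algebra_simps)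
  have "(\<Sum>i=1..length v. \<Sum>j=1..length w. real (deg v i) * (real (deg v i) - 1) *
      real (deg w j) * (real (deg w j) - 1)) =
    (\<Sum>i=1..length v. \<Sum>j=1..length w. real (deg v i * (deg v i - 1)) * real (deg w j * (deg w j - 1)))"
    by (simp only: falling[symmetric] mult.assoc)
  also have "\<dots> = real (\<Sum>i=1..length v. deg v i * (deg v i - 1)) * real (\<Sum>j=1..length w. deg w j * (deg w j - 1))"
    by (simp only: sum_product of_nat_sum)
  also have "\<dots> = real (pair_count v * pair_count w)"
    by (simp only: pc of_nat_mult)
  finally show ?thesis .
qed

text \<open>The hypotheses of the local lemma hold as soon as the largest row degree is a small
  fraction of \<open>N\<close>: each of the two conflict counts is controlled by \<open>K * N\<^sup>2\<close> if the largest degree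
  in it is large, and directly otherwise.\<close>

lemma ex_simple_prob_ge_exp:
  fixes K :: real
  assumes K: "K \<ge> 1"
  obtains \<epsilon> N\<^sub>1 where "\<epsilon> > 0"
    "\<And>r c N. sum_list r = N \<Longrightarrow> sum_list c = N \<Longrightarrow> sorted_wrt (\<ge>) r \<Longrightarrow> sorted_wrt (\<ge>) c \<Longrightarrow>
      deg c 1 \<le> deg r 1 \<Longrightarrow> 2 \<le> deg c 1 \<Longrightarrow> real (pair_count r * pair_count c) \<le> K * (real N)\<^sup>2 \<Longrightarrow>
      real (deg r 1) \<le> \<epsilon> * real N \<Longrightarrow> N\<^sub>1 \<le> N \<Longrightarrow> exp (- 8 * K) \<le> simple_prob r c"
proof -
  \<comment> \<open>Each conflict count is to be at most N^2/64: then 16 times their sum is at most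
    N^2/2 <= N(N-1). Degrees of at least \<open>M = 64 * K\<close> are handled by the product bound.
    Below \<open>M\<close>, the values of \<epsilon> and \<open>N1\<close> are chosen so that M N
    (\<epsilon> N) = N^2/64 and 64 M^2 <= N.\<close>
  define M where "M = 64 * K"
  define \<epsilon> where "\<epsilon> = 1 / (64 * M)"
  define N1 where "N1 = nat \<lceil>64 * M\<^sup>2\<rceil> + 3"
  have M: "M \<ge> 64" using K by (simp add: M_def)
  then have eps: "\<epsilon> > 0" by (simp add: \<epsilon>_def)
  show ?thesis
  proof (rule that[OF eps, of N1])
    fix r c N assume N: "sum_list r = N" "sum_list c = N"
      and sorted: "sorted_wrt (\<ge>) r" "sorted_wrt (\<ge>) c"
      and deg: "deg c 1 \<le> deg r 1" "2 \<le> deg c 1"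
      and prod: "real (pair_count r * pair_count c) \<le> K * (real N)\<^sup>2"
      and small: "real (deg r 1) \<le> \<epsilon> * real N" and NN: "N1 \<le> N"
    let ?R = "real (deg r 1)" and ?C = "real (deg c 1)"
    let ?p = "real (pair_count r)" and ?q = "real (pair_count c)"
    have N3: "N \<ge> 3" and NM: "64 * M\<^sup>2 \<le> real N"
      using NN unfolding N1_def by linarith+
    have R: "?R \<ge> 2" "?C \<ge> 2" using deg by auto
    have pge: "?R * (?R - 1) \<le> ?p" "?C * (?C - 1) \<le> ?q"
      using of_nat_mono[OF pair_count_ge_deg[of r], where 'a = real]
        of_nat_mono[OF pair_count_ge_deg[of c], where 'a = real] R
      by (auto simp: of_nat_diff)
    have ple: "?p \<le> real N * (?R - 1)" "?q \<le> real N * (?C - 1)"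
      using of_nat_mono[OF pair_count_le[OF sorted(1)], where 'a = real]
        of_nat_mono[OF pair_count_le[OF sorted(2)], where 'a = real] R N
      by (auto simp: of_nat_diff)
    have large: "64 * ((x - 1) * b) \<le> (real N)\<^sup>2"
      if "M \<le> x" "1 \<le> x" "x * (x - 1) \<le> a" "a * b \<le> K * (real N)\<^sup>2" "0 \<le> b" for x a b :: real
    proof -
      have "M * ((x - 1) * b) \<le> x * ((x - 1) * b)"
        using that by (intro mult_right_mono) auto
      also have "\<dots> \<le> a * b" using that(3,5) by (simp add: mult.assoc[symmetric] mult_right_mono)
      also have "\<dots> \<le> K * (real N)\<^sup>2" by fact
      finally have "K * (64 * ((x - 1) * b)) \<le> K * (real N)\<^sup>2" by (simp add: M_def mult_ac)
      then show ?thesis using K by simp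
    qed
    have first: "64 * ((?R - 1) * ?q) \<le> (real N)\<^sup>2"
    proof (cases "M \<le> ?R")
      case True
      then show ?thesis using large[of ?R ?p ?q] R pge prod by simp
    next
      case False
      have "(?R - 1) * ?q \<le> M * (real N * M)"
        using False ple(2) deg R M
        by (intro mult_mono order_trans[OF ple(2)]) auto
      then have "64 * ((?R - 1) * ?q) \<le> 64 * (M * (real N * M))" by (rule mult_left_mono) simp
      also have "\<dots> = (64 * M\<^sup>2) * real N" by (simp add: power2_eq_square mult_ac)
      also have "\<dots> \<le> real N * real N" using NM by (intro mult_right_mono) auto
      finally show ?thesis by (simp add: power2_eq_square)
    qed
    have second: "64 * ((?C - 1) * ?p) \<le> (real N)\<^sup>2"
    proof (cases "M \<le> ?C")
      case True
      then show ?thesis using large[of ?C ?q ?p] R pge prod by (simp add: mult.commute)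
    next
      case False
      \<comment> \<open>For bounded column degree the product bound is of no help, as
        \<open>pair_count r\<close> may be of order N times the first row degree. This is where that
        degree has to be at most \<epsilon> N.\<close>
      have "(?C - 1) * ?p \<le> M * (real N * (\<epsilon> * real N))"
        using False small R M eps
        by (intro mult_mono order_trans[OF ple(1)]) auto
      also have "\<dots> = (real N)\<^sup>2 / 64" using M by (simp add: \<epsilon>_def power2_eq_square)
      finally show ?thesis by simp
    qed
    have NN1: "real (N * (N - 1)) \<ge> (real N)\<^sup>2 / 2"
    proof -
      have "real N * 2 \<le> real N * real N" using N3 by (intro mult_left_mono) auto
      moreover have "real (N * (N - 1)) = real N * real N - real N"
        using N3 by (simp add: of_nat_diff algebra_simps)
      ultimately show ?thesis unfolding power2_eq_square by linarith
    qed
    have "real (16 * ((deg r 1 - 1) * pair_count c + (deg c 1 - 1) * pair_count r)) =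
        16 * ((?R - 1) * ?q) + 16 * ((?C - 1) * ?p)"
      using R by (simp add: of_nat_diff)
    also have "\<dots> \<le> real (N * (N - 1))" using first second NN1 by linarith
    finally have "16 * ((deg r 1 - 1) * pair_count c + (deg c 1 - 1) * pair_count r) \<le> N * (N - 1)"
      by (simp only: of_nat_le_iff)
    \<comment> \<open>Passing from N^2 to N(N-1) doubles \<open>K\<close>, whence the 8 in the
      exponent.\<close>
    moreover have "real (pair_count r * pair_count c) \<le> (2 * K) * real (N * (N - 1))"
    proof -
      have "2 * K * ((real N)\<^sup>2 / 2) \<le> 2 * K * real (N * (N - 1))"
        using NN1 K by (intro mult_left_mono) auto
      moreover have "2 * K * ((real N)\<^sup>2 / 2) = K * (real N)\<^sup>2" by simp
      ultimately show ?thesis using prod by linarith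
    qed
    ultimately have "exp (- 4 * (2 * K)) \<le> simple_prob r c"
      using nth_le_deg_1 sorted by (intro simple_prob_ge_exp[OF N N3, of "deg r 1" "deg c 1"]) auto
    then show "exp (- 8 * K) \<le> simple_prob r c" by simp
  qed
qed

text \<open>The result is a bound free of \<open>N\<close>: once \<open>pair_count c\<close> is at
  most half of the weight of a group, every constrained token succeeds with probability at least
  \<open>\<sigma> / 2\<close>, and there are at most \<open>K\<close> of them.\<close>

lemma simple_prob_ge_half_power:
  fixes \<sigma> :: real
  assumes N: "sum_list r = N" "sum_list c = N" "N > 0"
    and G: "\<And>k. k < q \<Longrightarrow> G k \<subseteq> {..<length r} \<and> real (\<Sum>i\<in>G k. r ! i) \<ge> \<sigma> * real N"
    and disj: "disjoint_family_on G {..<q}"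
    and q: "\<And>j. j < length c \<Longrightarrow> c ! j \<le> q"
    and K: "pair_count c \<le> K" "2 * real K \<le> \<sigma> * real N"
    and \<sigma>: "0 < \<sigma>" "\<sigma> \<le> 1"
  shows "(\<sigma> / 2) ^ K \<le> simple_prob r c"
proof -
  define s where "s = nat \<lceil>\<sigma> * real N\<rceil>"
  have s: "\<sigma> * real N \<le> real s" unfolding s_def by linarith
  have "\<sigma> * real N \<le> real N" using \<sigma> by (simp add: mult_left_le_one_le)
  then have sN: "s \<le> N" unfolding s_def by linarith
  have Ks: "2 * pair_count c \<le> s" using K s by linarith
  have "(\<sigma> / 2) ^ K \<le> (\<sigma> / 2) ^ pair_count c"
    using \<sigma> K by (intro power_decreasing) auto
  also have "\<dots> \<le> ((real s - real (pair_count c)) / real N) ^ pair_count c"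
  proof (intro power_mono)
    have "\<sigma> * real N / 2 \<le> real s - real (pair_count c)" using s Ks by linarith
    then show "\<sigma> / 2 \<le> (real s - real (pair_count c)) / real N"
      using N by (simp add: field_simps)
  qed (use \<sigma> in auto)
  also have "\<dots> \<le> simple_prob r c"
  proof (rule simple_prob_ge_groups[OF N _ disj q])
    show "G k \<subseteq> {..<length r} \<and> s \<le> (\<Sum>i\<in>G k. r ! i)" if "k < q" for k
      using G[OF that] unfolding s_def by (simp add: nat_le_iff ceiling_le_iff)
  qed (use Ks sN in auto)
  finally show ?thesis .
qed

text \<open>Elements are dropped while the sum stays at least \<open>s\<close>. When dropping
  \<open>x\<close> would bring it below \<open>s\<close>, the sum exceeds \<open>s\<close> by at
  most \<open>w x\<close>, hence by at most \<open>h\<close>.\<close>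

lemma ex_subset_sum_between:
  fixes w :: "'a \<Rightarrow> real"
  assumes "finite I" "\<And>i. i \<in> I \<Longrightarrow> w i \<le> h" "s \<le> sum w I" "0 \<le> s" "0 \<le> h"
  shows "\<exists>J\<subseteq>I. s \<le> sum w J \<and> sum w J \<le> s + h"
  using assms
proof (induction I rule: finite_induct)
  case empty
  then show ?case by auto
next
  case (insert x I)
  show ?case
  proof (cases "s \<le> sum w I")
    case True
    then obtain J where "J \<subseteq> I" "s \<le> sum w J" "sum w J \<le> s + h"
      using insert by auto
    then show ?thesis by blast
  next
    case False
    moreover have "w x \<le> h" using insert.prems by simp
    ultimately have "sum w (insert x I) \<le> s + h" using insert.hyps by simp
    then show ?thesis using insert.prems(2) by blast
  qed
qed

text \<open>The groups are split off one by one, and each uses up weight at most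
  \<open>s + h\<close>; hence the required total.\<close>

lemma ex_disjoint_groups:
  fixes w :: "'a \<Rightarrow> real"
  assumes "finite I" "\<And>i. i \<in> I \<Longrightarrow> w i \<le> h" "real q * (s + h) \<le> sum w I" "0 \<le> s" "0 \<le> h"
  shows "\<exists>G. disjoint_family_on G {..<q} \<and> (\<forall>k<q. G k \<subseteq> I \<and> s \<le> sum w (G k))"
  using assms
proof (induction q arbitrary: I)
  case 0
  then show ?case by (auto simp: disjoint_family_on_def)
next
  case (Suc q)
  have "0 \<le> real q * (s + h)" using Suc.prems by simp
  moreover have Suc_sum: "real (Suc q) * (s + h) = real q * (s + h) + (s + h)"
    by (simp add: algebra_simps)
  ultimately have "s \<le> sum w I" using Suc.prems by linarith
  then obtain J where J: "J \<subseteq> I" "s \<le> sum w J" "sum w J \<le> s + h"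
    using ex_subset_sum_between[of I w h s] Suc.prems by blast
  have "real q * (s + h) \<le> sum w (I - J)"
    using Suc.prems(1,3) J Suc_sum by (simp add: sum_diff)
  then have "\<exists>G. disjoint_family_on G {..<q} \<and> (\<forall>k<q. G k \<subseteq> I - J \<and> s \<le> sum w (G k))"
    using Suc.prems by (intro Suc.IH) auto
  then obtain G where G: "disjoint_family_on G {..<q}" "\<And>k. k < q \<Longrightarrow> G k \<subseteq> I - J \<and> s \<le> sum w (G k)"
    by blast
  have "disjoint_family_on (G(q := J)) {..<Suc q}"
    unfolding disjoint_family_on_def
  proof (intro ballI impI)
    fix m n assume mn: "m \<in> {..<Suc q}" "n \<in> {..<Suc q}" "m \<noteq> n"
    consider "m = q" "n < q" | "n = q" "m < q" | "m < q" "n < q" using mn by force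
    then show "(G(q := J)) m \<inter> (G(q := J)) n = {}"
    proof cases
      case 1
      then show ?thesis using G(2)[of n] by auto
    next
      case 2
      then show ?thesis using G(2)[of m] by auto
    next
      case 3
      then show ?thesis using G(1) mn(3) by (auto simp: disjoint_family_on_def)
    qed
  qed
  moreover have "(G(q := J)) k \<subseteq> I \<and> s \<le> sum w ((G(q := J)) k)" if "k < Suc q" for k
    using that G(2)[of k] J by (cases "k = q") auto
  ultimately show ?case by blast
qed

text \<open>Rows are counted from 1 in \<open>kappa\<close> and from 0 in lists, so the tail
  starting at row \<open>Suc q\<close> starts at list index \<open>q\<close>.\<close>

lemma tail_mass_eq:
  assumes "kappa S = enat (Suc q)"
  shows "tail_mass S l = (\<Sum>i\<in>{q..<length (row_degs (S l))}. real (row_degs (S l) ! i)) / real (total (S l))"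
proof -
  let ?v = "row_degs (S l)" and ?n = "real (total (S l))"
  have "tail_mass S l = (\<Sum>i\<in>{Suc q..length ?v}. if kappa S \<le> enat i then real (deg ?v i) / ?n else 0)"
    unfolding tail_mass_def by (rule suminf_finite) (auto simp: deg_def assms)
  also have "\<dots> = (\<Sum>i\<in>{Suc q..<Suc (length ?v)}. real (deg ?v i) / ?n)"
    by (intro sum.cong) (auto simp: assms)
  also have "\<dots> = (\<Sum>i\<in>{q..<length ?v}. real (deg ?v (Suc i)) / ?n)"
    by (rule sum.shift_bounds_Suc_ivl)
  also have "\<dots> = (\<Sum>i\<in>{q..<length ?v}. real (?v ! i) / ?n)"
    by (intro sum.cong) (auto simp: deg_Suc)
  finally show ?thesis by (simp add: sum_divide_distrib)
qed

section \<open>Subsequences\<close>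

text \<open>The property may depend on the position \<open>l\<close>, so that a subsequence can
  force its l-th probability below 1/(l+1).\<close>

lemma strict_mono_choice:
  fixes P :: "nat \<Rightarrow> nat \<Rightarrow> bool"
  assumes "\<And>l m. \<exists>n\<ge>m. P l n"
  shows "\<exists>k. strict_mono k \<and> (\<forall>l. P l (k l))"
proof -
  have "\<exists>k. \<forall>l. P l (k l) \<and> k l < k (Suc l)"
  proof (rule dependent_nat_choice)
    show "\<exists>n. P 0 n" using assms by blast
    show "\<exists>n'. P (Suc l) n' \<and> n < n'" for l n
      using assms[of "Suc n" "Suc l"] by (meson Suc_le_eq)
  qed
  then show ?thesis unfolding strict_mono_Suc_iff by blast
qed

lemma frequently_strict_mono:
  assumes "\<exists>\<^sub>F n :: nat in sequentially. P n"
  shows "\<exists>k :: nat \<Rightarrow> nat. strict_mono k \<and> (\<forall>l. P (k l))"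
  by (rule strict_mono_choice[of "\<lambda>_. P"]) (use assms in \<open>simp add: frequently_sequentially\<close>)

lemma limsup_pos_frequently:
  fixes f :: "nat \<Rightarrow> real"
  assumes "0 < limsup (\<lambda>l. ereal (f l))"
  obtains \<tau> where "\<tau> > 0" "\<exists>\<^sub>F l in sequentially. \<tau> \<le> f l"
proof -
  obtain \<tau> where \<tau>: "0 < ereal \<tau>" "ereal \<tau> < limsup (\<lambda>l. ereal (f l))"
    using ereal_dense2[OF assms] by blast
  have "\<exists>\<^sub>F l in sequentially. \<tau> \<le> f l"
  proof (rule ccontr)
    assume "\<not> ?thesis"
    then have "\<forall>\<^sub>F l in sequentially. \<not> \<tau> \<le> f l"
      by (simp only: not_frequently)
    then have "\<forall>\<^sub>F l in sequentially. ereal (f l) \<le> ereal \<tau>"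
      by (rule eventually_mono) simp
    then have "limsup (\<lambda>l. ereal (f l)) \<le> ereal \<tau>"
      by (rule Limsup_bounded)
    then show False using \<tau>(2) by (simp only: leD)
  qed
  then show thesis using \<tau>(1) that by simp
qed

text \<open>If the claim failed, the probability of a simple table would tend to 0 along some
  subsequence \<open>k\<close>. By the local lemma the first row is linear along \<open>k\<close>, so the number \<open>pair_count\<close>
  of column twins stays bounded. Choose \<open>q\<close> maximal such that the first \<open>q\<close> rows are linear along a
  further subsequence. There \<open>kappa\<close> equals \<open>q + 1\<close>, and the second hypothesis yields enough
  disjoint groups of rows of linear weight: the \<open>q\<close> linear rows themselves, or a partition of a
  tail of positive mass.\<close>

lemma eventually_simple_prob_ge:
  assumes inp: "input_sequence r c"
    and deg: "\<And>N. N \<ge> 2 \<Longrightarrow> deg (r N) 1 \<ge> deg (c N) 1 \<and> deg (c N) 1 \<ge> 2"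
    and big: "(\<lambda>N. real (pair_count (r N) * pair_count (c N))) \<in> O(\<lambda>N. (real N)\<^sup>2)"
    and subseq: "\<And>S'. is_subsequence S' (tuples r c) \<Longrightarrow>
            limsup (\<lambda>l. ereal (tail_mass S' l)) > 0 \<or>
            limsup (\<lambda>l. ereal (real (deg (col_degs (S' l)) 1))) < ereal_of_enat (kappa S')"
  shows "\<exists>d>0. \<forall>\<^sub>F N in sequentially. d \<le> simple_prob (r N) (c N)"
proof (rule ccontr)
  assume contra: "\<not> ?thesis"
  have N: "sum_list (r N) = N" "sum_list (c N) = N" "sorted_wrt (\<ge>) (r N)" "sorted_wrt (\<ge>) (c N)"
    if "N \<ge> 2" for N
    using inp that by (auto simp: input_sequence_def)
  obtain K0 where "\<forall>\<^sub>F N in sequentially. norm (real (pair_count (r N) * pair_count (c N))) \<le> K0 * norm ((real N)\<^sup>2)"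
    using big by (auto elim: landau_o.bigE)
  then obtain N0 where N0: "\<And>N. N \<ge> N0 \<Longrightarrow> real (pair_count (r N) * pair_count (c N)) \<le> K0 * (real N)\<^sup>2"
    unfolding eventually_sequentially by auto
  define K where "K = max K0 1"
  have K: "K \<ge> 1" by (simp add: K_def)
  have prod: "real (pair_count (r N) * pair_count (c N)) \<le> K * (real N)\<^sup>2" if "N \<ge> N0" for N
    using N0[OF that] by (rule order_trans) (auto simp: K_def intro: mult_right_mono)
  obtain \<epsilon> N1 where eps: "\<epsilon> > 0"
    and LLL: "\<And>r c N. sum_list r = N \<Longrightarrow> sum_list c = N \<Longrightarrow> sorted_wrt (\<ge>) r \<Longrightarrow> sorted_wrt (\<ge>) c \<Longrightarrow>
      deg c 1 \<le> deg r 1 \<Longrightarrow> 2 \<le> deg c 1 \<Longrightarrow> real (pair_count r * pair_count c) \<le> K * (real N)\<^sup>2 \<Longrightarrow>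
      real (deg r 1) \<le> \<epsilon> * real N \<Longrightarrow> N1 \<le> N \<Longrightarrow> exp (- 8 * K) \<le> simple_prob r c"
    using ex_simple_prob_ge_exp[OF K] by blast
  define N2 where "N2 = max 2 (max N0 N1)"

  have "\<exists>n\<ge>m. n \<ge> N2 \<and> \<epsilon> * real n < real (deg (r n) 1) \<and> simple_prob (r n) (c n) < 1 / real (Suc l)" for l m
  proof -
    \<comment> \<open>Being below the first term contradicts the local lemma unless the first row
      exceeds \<epsilon> n; being below the second drives the probabilities to 0.\<close>
    define d where "d = min (exp (- 8 * K)) (1 / real (Suc l))"
    have "d > 0" by (simp add: d_def)
    then have "\<exists>\<^sub>F n in sequentially. simple_prob (r n) (c n) < d"
      using contra unfolding frequently_def not_less by blast
    then obtain n where n: "n \<ge> max m N2" "simple_prob (r n) (c n) < d"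
      unfolding frequently_sequentially by blast
    have "\<not> real (deg (r n) 1) \<le> \<epsilon> * real n"
    proof
      assume "real (deg (r n) 1) \<le> \<epsilon> * real n"
      then have "exp (- 8 * K) \<le> simple_prob (r n) (c n)"
        using n(1) N[of n] deg[of n] prod[of n] by (intro LLL[of "r n" n "c n"]) (auto simp: N2_def)
      then show False using n(2) by (simp add: d_def)
    qed
    then show ?thesis using n by (auto simp: d_def)
  qed
  then obtain k where k: "strict_mono k"
    and kN2: "\<And>l. k l \<ge> N2" and k_large: "\<And>l. \<epsilon> * real (k l) < real (deg (r (k l)) 1)"
    and k_prob: "\<And>l. simple_prob (r (k l)) (c (k l)) < 1 / real (Suc l)"
    using strict_mono_choice[of "\<lambda>l n. n \<ge> N2 \<and> \<epsilon> * real n < real (deg (r n) 1) \<and>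
      simple_prob (r n) (c n) < 1 / real (Suc l)"] by blast
  have k2: "k l \<ge> 2" "k l \<ge> N0" for l using kN2[of l] by (auto simp: N2_def)

  have no_lower_bound: False
    if s: "strict_mono s" and d: "d > 0"
      and freq: "\<exists>\<^sub>F l in sequentially. d \<le> simple_prob (r (k (s l))) (c (k (s l)))" for s d
  proof -
    obtain l where l: "l \<ge> nat \<lceil>1 / d\<rceil>" "d \<le> simple_prob (r (k (s l))) (c (k (s l)))"
      using freq unfolding frequently_sequentially by blast
    have "l \<le> s l" using s by (rule strict_mono_imp_increasing)
    then have "1 / d \<le> real (s l)" using l(1) by linarith
    then have "1 / d < real (Suc (s l))" by simp
    then have "1 / real (Suc (s l)) < d" using d by (simp add: field_simps)
    then show False using k_prob[of "s l"] l(2) by linarith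
  qed

  \<comment> \<open>A first row of degree R > \<epsilon> N gives R(R-1) >= \<epsilon>^2 N^2 / 2, so
    the bound K N^2 on the product leaves at most 2K/\<epsilon>^2 for the column pairs.\<close>
  define B where "B = nat \<lceil>2 * K / \<epsilon>\<^sup>2\<rceil>"
  have cB: "pair_count (c (k l)) \<le> B" for l
  proof -
    let ?R = "real (deg (r (k l)) 1)" and ?q = "real (pair_count (c (k l)))" and ?N = "real (k l)"
    have R2: "?R \<ge> 2" using deg[OF k2(1)[of l]] by auto
    have "(\<epsilon> * ?N) * (\<epsilon> * ?N) \<le> ?R * ?R"
      using k_large[of l] eps by (intro mult_mono) auto
    also have "\<dots> \<le> 2 * (?R * (?R - 1))"
    proof -
      have "2 * ?R \<le> ?R * ?R" using R2 by (intro mult_right_mono) auto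
      then show ?thesis by (simp add: algebra_simps)
    qed
    also have "?R * (?R - 1) \<le> real (pair_count (r (k l)))"
      using of_nat_mono[OF pair_count_ge_deg[of "r (k l)"], where 'a = real] R2 by (auto simp: of_nat_diff)
    finally have "(\<epsilon> * ?N) * (\<epsilon> * ?N) * ?q \<le> 2 * real (pair_count (r (k l))) * ?q"
      by (intro mult_right_mono) auto
    also have "\<dots> \<le> 2 * (K * ?N\<^sup>2)" using prod[OF k2(2)[of l]] by simp
    finally have "?N\<^sup>2 * (\<epsilon>\<^sup>2 * ?q) \<le> ?N\<^sup>2 * (2 * K)" by (simp add: power2_eq_square mult_ac)
    moreover have "?N\<^sup>2 > 0" using k2(1)[of l] by simp
    ultimately have "\<epsilon>\<^sup>2 * ?q \<le> 2 * K" by simp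
    then have "?q \<le> 2 * K / \<epsilon>\<^sup>2" using eps by (simp add: field_simps)
    then show ?thesis unfolding B_def by linarith
  qed
  have c1B: "deg (c (k l)) 1 \<le> B" for l
  proof -
    have "deg (c (k l)) 1 * 1 \<le> deg (c (k l)) 1 * (deg (c (k l)) 1 - 1)"
      using deg[OF k2(1)[of l]] by (intro mult_le_mono2) auto
    then show ?thesis using pair_count_ge_deg[of "c (k l)"] cB[of l] by linarith
  qed
  have k_ge: "l \<le> k (s l)" if "strict_mono s" for s l
    using strict_mono_imp_increasing[OF that, of l] strict_mono_imp_increasing[OF k, of "s l"] by linarith
  have c_le: "c (k l) ! j \<le> m" if "deg (c (k l)) 1 \<le> m" "j < length (c (k l))" for l j m
    using nth_le_deg_1[OF N(4)[OF k2(1)] that(2)] that(1) by linarith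

  have no_groups: False
    if s: "strict_mono s" and \<sigma>: "0 < \<sigma>" "\<sigma> \<le> 1"
      and freq: "\<exists>\<^sub>F l in sequentially. deg (c (k (s l))) 1 \<le> q \<and>
        (\<exists>G. disjoint_family_on G {..<q} \<and> (\<forall>i<q. G i \<subseteq> {..<length (r (k (s l)))} \<and>
           \<sigma> * real (k (s l)) \<le> real (\<Sum>i\<in>G i. r (k (s l)) ! i)))"
    for s :: "nat \<Rightarrow> nat" and \<sigma> :: real and q
  proof (rule no_lower_bound[OF s, of "(\<sigma> / 2) ^ B"])
    have "\<forall>\<^sub>F l in sequentially. 2 * real B \<le> \<sigma> * real (k (s l))"
    proof (rule eventually_sequentiallyI)
      fix l assume "nat \<lceil>2 * real B / \<sigma>\<rceil> \<le> l"
      then have "2 * real B / \<sigma> \<le> real (k (s l))" using k_ge[OF s, of l] by linarith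
      then show "2 * real B \<le> \<sigma> * real (k (s l))" using \<sigma> by (simp add: field_simps)
    qed
    with freq have "\<exists>\<^sub>F l in sequentially. (deg (c (k (s l))) 1 \<le> q \<and>
        (\<exists>G. disjoint_family_on G {..<q} \<and> (\<forall>i<q. G i \<subseteq> {..<length (r (k (s l)))} \<and>
           \<sigma> * real (k (s l)) \<le> real (\<Sum>i\<in>G i. r (k (s l)) ! i)))) \<and> 2 * real B \<le> \<sigma> * real (k (s l))"
      by (rule frequently_eventually_frequently)
    then show "\<exists>\<^sub>F l in sequentially. (\<sigma> / 2) ^ B \<le> simple_prob (r (k (s l))) (c (k (s l)))"
    proof (rule frequently_elim1, elim conjE exE)
      fix l G assume l: "deg (c (k (s l))) 1 \<le> q" "2 * real B \<le> \<sigma> * real (k (s l))"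
        and G: "disjoint_family_on G {..<q}"
          "\<forall>i<q. G i \<subseteq> {..<length (r (k (s l)))} \<and> \<sigma> * real (k (s l)) \<le> real (\<Sum>i\<in>G i. r (k (s l)) ! i)"
      show "(\<sigma> / 2) ^ B \<le> simple_prob (r (k (s l))) (c (k (s l)))"
        using N[OF k2(1)[of "s l"]] k2(1)[of "s l"] G(2) c_le[OF l(1)]
        by (intro simple_prob_ge_half_power[OF _ _ _ _ G(1) _ cB l(2) \<sigma>]) auto
    qed
  qed (use \<sigma> in simp)

  \<comment> \<open>\<open>Q q\<close> says that, along some refinement of \<open>k\<close>, row
    \<open>q\<close> has at least a fixed fraction of all tokens. By monotonicity so does every
    earlier row.\<close>
  define Q where "Q q \<longleftrightarrow> (\<exists>(s :: nat \<Rightarrow> nat) \<rho>. strict_mono s \<and> \<rho> > 0 \<and>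
    (\<forall>l. \<rho> * real (k (s l)) \<le> real (deg (r (k (s l))) q)))" for q

  have no_linear_rows: False
    if s: "strict_mono s" and \<rho>: "\<rho> > 0" and lin: "\<And>l. \<rho> * real (k (s l)) \<le> real (deg (r (k (s l))) q)"
      and freq: "\<exists>\<^sub>F l in sequentially. deg (c (k (s l))) 1 \<le> q"
    for s :: "nat \<Rightarrow> nat" and \<rho> :: real and q
  \<comment> \<open>The groups are the singletons of the first \<open>q\<close> rows. The minimum
    with 1 meets the condition \<open>\<sigma> \<le> 1\<close>.\<close>
  proof (rule no_groups[OF s, of "min \<rho> 1" q])
    show "\<exists>\<^sub>F l in sequentially. deg (c (k (s l))) 1 \<le> q \<and>
        (\<exists>G. disjoint_family_on G {..<q} \<and> (\<forall>i<q. G i \<subseteq> {..<length (r (k (s l)))} \<and>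
           min \<rho> 1 * real (k (s l)) \<le> real (\<Sum>i\<in>G i. r (k (s l)) ! i)))"
      using freq
    proof (rule frequently_elim1)
      fix l assume l: "deg (c (k (s l))) 1 \<le> q"
      have "i < length (r (k (s l))) \<and> min \<rho> 1 * real (k (s l)) \<le> real (r (k (s l)) ! i)" if "i < q" for i
      proof -
        have "0 < \<rho> * real (k (s l))" using \<rho> k2(1)[of "s l"] by simp
        then have "deg (r (k (s l))) q > 0" using lin[of l] by linarith
        then have "q \<le> length (r (k (s l)))" by (simp add: deg_def split: if_splits)
        then have i: "i < length (r (k (s l)))" using that by simp
        have "deg (r (k (s l))) q \<le> deg (r (k (s l))) (Suc i)"
          using that by (intro deg_antimono N(3)[OF k2(1)]) auto
        moreover have "min \<rho> 1 * real (k (s l)) \<le> \<rho> * real (k (s l))"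
          by (intro mult_right_mono) auto
        ultimately show ?thesis using lin[of l] i by (simp add: deg_Suc)
      qed
      then show "deg (c (k (s l))) 1 \<le> q \<and>
        (\<exists>G. disjoint_family_on G {..<q} \<and> (\<forall>i<q. G i \<subseteq> {..<length (r (k (s l)))} \<and>
           min \<rho> 1 * real (k (s l)) \<le> real (\<Sum>i\<in>G i. r (k (s l)) ! i)))"
        using l by (intro conjI exI[of _ "\<lambda>i. {i}"]) (auto simp: disjoint_family_on_def)
    qed
  qed (use \<rho> in auto)

  have "Q 1"
    unfolding Q_def
    by (rule exI[of _ "\<lambda>l. l"], rule exI[of _ \<epsilon>])
      (use k_large eps in \<open>auto simp: strict_mono_def less_imp_le\<close>)
  \<comment> \<open>Column degrees are at most \<open>B\<close> along \<open>k\<close>, so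
    \<open>Suc B\<close> linear rows would already provide enough groups. This bounds the values of
    \<open>q\<close> and makes a maximal one available.\<close>
  have "\<not> Q (Suc B)"
  proof
    assume "Q (Suc B)"
    then obtain s :: "nat \<Rightarrow> nat" and \<rho> where s: "strict_mono s" "0 < \<rho>"
      "\<forall>l. \<rho> * real (k (s l)) \<le> real (deg (r (k (s l))) (Suc B))"
      unfolding Q_def by blast
    have "\<exists>\<^sub>F l in sequentially. deg (c (k (s l))) 1 \<le> Suc B"
      by (intro eventually_frequently always_eventually allI le_SucI c1B) simp
    then show False by (rule no_linear_rows[OF s(1,2) s(3)[rule_format]])
  qed
  have "\<exists>q\<ge>1. Q q \<and> \<not> Q (Suc q)"
  proof (rule ccontr)
    assume no: "\<not> ?thesis"
    have "Q (Suc n)" for n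
      by (induction n) (use \<open>Q 1\<close> no in auto)
    then show False using \<open>\<not> Q (Suc B)\<close> by blast
  qed
  then obtain q and s :: "nat \<Rightarrow> nat" and \<rho> where q: "q \<ge> 1" "\<not> Q (Suc q)" and s: "strict_mono s" and \<rho>: "\<rho> > 0"
    and lin: "\<And>l. \<rho> * real (k (s l)) \<le> real (deg (r (k (s l))) q)"
    unfolding Q_def by blast

  define S where "S l = tuples r c (k (s l))" for l
  have S: "row_degs (S l) = r (k (s l))" "col_degs (S l) = c (k (s l))" "total (S l) = k (s l)" for l
    by (simp_all add: S_def tuples_def)
  have "strict_mono (\<lambda>l. k (s l))" using strict_mono_o[OF k s] by (simp add: comp_def)
  then have sub: "is_subsequence S (tuples r c)"
    unfolding is_subsequence_def S_def using k2(1) by blast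
  have not_sublinear: "\<not> sublinear_row S i" if i: "1 \<le> i" "i \<le> q" for i
  proof
    assume "sublinear_row S i"
    then have "\<forall>\<^sub>F l in sequentially. norm (real (deg (r (k (s l))) i)) \<le> \<rho> / 2 * norm (real (k (s l)))"
      using \<rho> unfolding sublinear_row_def S by (intro landau_o.smallD) auto
    then have "\<exists>l. norm (real (deg (r (k (s l))) i)) \<le> \<rho> / 2 * norm (real (k (s l)))"
      by (rule eventually_happens'[OF sequentially_bot])
    then obtain l where l: "real (deg (r (k (s l))) i) \<le> \<rho> / 2 * real (k (s l))"
      unfolding real_norm_def abs_of_nat by blast
    have "deg (r (k (s l))) q \<le> deg (r (k (s l))) i"
      using i by (intro deg_antimono N(3)[OF k2(1)]) auto
    then have "\<rho> * real (k (s l)) \<le> \<rho> / 2 * real (k (s l))" using l lin[of l] by linarith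
    moreover have "0 < \<rho> * real (k (s l))" using \<rho> k2(1)[of "s l"] by simp
    ultimately show False by linarith
  qed
  \<comment> \<open>Maximality of \<open>q\<close> yields convergence along all of \<open>s\<close>:
    indices violating the bound infinitely often would form a refinement witnessing
    \<open>Q (Suc q)\<close>.\<close>
  have small_deg: "\<forall>\<^sub>F l in sequentially. real (deg (r (k (s l))) (Suc q)) \<le> e * real (k (s l))" if e: "e > 0" for e
  proof (rule ccontr)
    assume "\<not> ?thesis"
    then have "\<exists>\<^sub>F l in sequentially. e * real (k (s l)) \<le> real (deg (r (k (s l))) (Suc q))"
      unfolding not_eventually by (rule frequently_elim1) simp
    then obtain s' :: "nat \<Rightarrow> nat" where s': "strict_mono s'"
        "\<forall>l. e * real (k (s (s' l))) \<le> real (deg (r (k (s (s' l)))) (Suc q))"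
      using frequently_strict_mono by blast
    have "strict_mono (\<lambda>l. s (s' l))" using strict_mono_o[OF s s'(1)] by (simp add: comp_def)
    then have "Q (Suc q)" unfolding Q_def using s'(2) e by blast
    then show False using q by simp
  qed
  have "sublinear_row S (Suc q)"
    unfolding sublinear_row_def S using small_deg by (intro landau_o.smallI) simp
  then have kap: "kappa S = enat (Suc q)"
    unfolding kappa_def using not_sublinear
    by (auto intro!: Least_equality simp: not_less_eq_eq[symmetric])

  show False
    using subseq[OF sub]
  proof
    assume "limsup (\<lambda>l. ereal (real (deg (col_degs (S l)) 1))) < ereal_of_enat (kappa S)"
    then have "\<forall>\<^sub>F l in sequentially. ereal (real (deg (col_degs (S l)) 1)) < ereal_of_enat (kappa S)"
      by (rule Limsup_lessD)
    then have "\<forall>\<^sub>F l in sequentially. deg (c (k (s l))) 1 \<le> q"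
      by (rule eventually_mono) (simp add: kap S)
    then have "\<exists>\<^sub>F l in sequentially. deg (c (k (s l))) 1 \<le> q"
      by (rule eventually_frequently[rotated]) simp
    then show False by (rule no_linear_rows[OF s \<rho> lin])
  next
    assume pos: "0 < limsup (\<lambda>l. ereal (tail_mass S l))"
    obtain \<tau> where \<tau>: "\<tau> > 0" "\<exists>\<^sub>F l in sequentially. \<tau> \<le> tail_mass S l"
      using pos by (rule limsup_pos_frequently)
    \<comment> \<open>By \<open>c1B\<close>, \<open>m\<close> groups are enough for every column,
      and the successor makes \<open>m\<close> positive. Tail rows are at most h N each, so every
      group of weight at least h N can be kept below 2 h N, and \<open>m\<close> of them fit into
      the tail mass \<tau> N.\<close>
    define m where "m = Suc B"
    define h where "h = min (\<tau> / (2 * real m)) 1"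
    have "real m > 0" by (simp add: m_def)
    then have "2 * real m * (\<tau> / (2 * real m)) = \<tau>" by simp
    moreover have "2 * real m * h \<le> 2 * real m * (\<tau> / (2 * real m))"
      unfolding h_def by (intro mult_left_mono) simp_all
    moreover have "h > 0" using \<tau>(1) \<open>real m > 0\<close> by (simp add: h_def)
    ultimately have h: "0 < h" "h \<le> 1" "2 * real m * h \<le> \<tau>"
      by (simp_all add: h_def)
    have "\<exists>\<^sub>F l in sequentially. \<tau> \<le> tail_mass S l \<and> real (deg (r (k (s l))) (Suc q)) \<le> h * real (k (s l))"
      using \<tau>(2) small_deg[OF h(1)] by (rule frequently_eventually_frequently)
    then have "\<exists>\<^sub>F l in sequentially. deg (c (k (s l))) 1 \<le> m \<and>
        (\<exists>G. disjoint_family_on G {..<m} \<and> (\<forall>i<m. G i \<subseteq> {..<length (r (k (s l)))} \<and>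
           h * real (k (s l)) \<le> real (\<Sum>i\<in>G i. r (k (s l)) ! i)))"
    proof (rule frequently_elim1, elim conjE)
      fix l assume l: "\<tau> \<le> tail_mass S l" "real (deg (r (k (s l))) (Suc q)) \<le> h * real (k (s l))"
      let ?v = "r (k (s l))" and ?N = "real (k (s l))"
      have N0: "?N > 0" using k2(1)[of "s l"] by simp
      have "\<tau> * ?N \<le> (\<Sum>i\<in>{q..<length ?v}. real (?v ! i))"
        using l(1) N0 unfolding tail_mass_eq[OF kap] S by (simp add: field_simps)
      moreover have "real m * (h * ?N + h * ?N) \<le> \<tau> * ?N"
        using mult_right_mono[OF h(3), of ?N] N0 by (simp add: algebra_simps)
      ultimately have total: "real m * (h * ?N + h * ?N) \<le> (\<Sum>i\<in>{q..<length ?v}. real (?v ! i))"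
        by linarith
      have each: "real (?v ! i) \<le> h * ?N" if "i \<in> {q..<length ?v}" for i
      proof -
        have "deg ?v (Suc i) \<le> deg ?v (Suc q)"
          using that by (intro deg_antimono N(3)[OF k2(1)]) auto
        then show ?thesis using l(2) that by (simp add: deg_Suc)
      qed
      obtain G where G: "disjoint_family_on G {..<m}"
        "\<forall>i<m. G i \<subseteq> {q..<length ?v} \<and> h * ?N \<le> (\<Sum>i\<in>G i. real (?v ! i))"
        using ex_disjoint_groups[OF _ each total] h N0 by auto
      have "G i \<subseteq> {..<length ?v} \<and> h * ?N \<le> real (\<Sum>i\<in>G i. ?v ! i)" if "i < m" for i
        using G(2)[rule_format, OF that] by auto
      then show "deg (c (k (s l))) 1 \<le> m \<and>
        (\<exists>G. disjoint_family_on G {..<m} \<and> (\<forall>i<m. G i \<subseteq> {..<length ?v} \<and>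
           h * ?N \<le> real (\<Sum>i\<in>G i. ?v ! i)))"
        using c1B[of "s l"] G(1) unfolding m_def by auto
    qed
    then show False by (rule no_groups[OF s h(1,2)])
  qed
qed

theorem corollary1p6:
  fixes r c :: "nat \<Rightarrow> nat list"
    and A :: "nat mat \<Rightarrow> bool"
  assumes "input_sequence r c"
    and "\<And>N. N \<ge> 2 \<Longrightarrow> deg (r N) 1 \<ge> deg (c N) 1 \<and> deg (c N) 1 \<ge> 2"
    and "(\<lambda>N. \<Sum>i=1..length (r N). \<Sum>j=1..length (c N).
            real (deg (r N) i) * (real (deg (r N) i) - 1) *
            real (deg (c N) j) * (real (deg (c N) j) - 1)) \<in> O(\<lambda>N. (real N)\<^sup>2)"
    and "\<And>S'. is_subsequence S' (tuples r c) \<Longrightarrow>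
            limsup (\<lambda>l. ereal (tail_mass S' l)) > 0 \<or>
            limsup (\<lambda>l. ereal (real (deg (col_degs (S' l)) 1))) < ereal_of_enat (kappa S')"
    and "(\<lambda>N. 1 - prob_configuration (r N) (c N) A) \<in> o(\<lambda>_. 1)"
  shows "(\<lambda>N. 1 - prob_uniform (r N) (c N) A) \<in> o(\<lambda>_. 1)"
proof -
  obtain d where d: "d > 0" "\<forall>\<^sub>F N in sequentially. d \<le> simple_prob (r N) (c N)"
    using eventually_simple_prob_ge[OF assms(1,2) assms(3)[unfolded sum_deg_products_eq] assms(4)]
    by blast
  have "(\<lambda>N. 1 - prob_uniform (r N) (c N) A) \<in> O(\<lambda>N. 1 - prob_configuration (r N) (c N) A)"
  proof (rule landau_o.bigI[of "1 / d"])
    show "\<forall>\<^sub>F N in sequentially. norm (1 - prob_uniform (r N) (c N) A)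
        \<le> 1 / d * norm (1 - prob_configuration (r N) (c N) A)"
      using d(2) eventually_ge_at_top[of 2]
    proof eventually_elim
      case (elim N)
      have "sum_list (r N) = sum_list (c N)"
        using assms(1) elim by (simp add: input_sequence_def)
      note le = uniform_failure_le[OF this d(1) elim(1), of A]
      have "prob_configuration (r N) (c N) A \<le> 1" by (simp add: prob_configuration_def)
      then show ?case using le by simp
    qed
  qed (use d in simp)
  then show ?thesis using assms(5) by (rule landau_o.big_small_trans)
qed

end
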